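(* Let $F$ be a differential field of characteristic zero with algebraically closed field of constants $C$, and suppose $F=C(t_1,\dots,t_m)[z_1,\dots,z_k]$, where $t_1,\dots,t_m$ are algebraically independent over $C$ and $z_1,\dots,z_k$ are algebraic over $C(t_1,\dots,t_m)$. Let $n\ge1$, let $f_{ij}\in F$ ($1\le i,j\le n$), and let $F(X_{ij})$ be the field of rational functions in $n^2$ algebraically independent variables $X_{ij}$, with the derivation extending that of $F$ and satisfying $D(X_{ij})=\sum_{\ell=1}^n f_{i\ell}X_{\ell j}$. For $k\ge1$ let $W_k(Y_{ij})\in F\{Y_{ij}\}[X_{ij}]$ be the wronskian of the set $\mathbb{T}_k$ of monomials in both the $t_i$ and the $X_{ij}$ of total degree at most $k$. Then $F(X_{ij})\supset F$ is a Picard-Vessiot extension for $\mathrm{GL}_n(C)$ if and only if all the wronskians $W_k(Y_{ij})$, $k\ge1$, map to nonzero elements of $F(X_{ij})$ via the specialization $Y_{ij}\mapsto f_{ij}$.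
   Context: $F\{Y_{ij}\}[X_{ij}]$ is the polynomial ring in algebraically independent variables $X_{ij}$ ($1\le i,j\le n$) over the ring $F\{Y_{ij}\}$ of differential polynomials in differential indeterminates $Y_{ij}$ ($1\le i,j\le n$) over $F$; its derivation extends that of $F\{Y_{ij}\}$ and satisfies $D(X_{ij})=\sum_{\ell=1}^n Y_{i\ell}X_{\ell j}$. The wronskian of elements $y_1,\dots,y_N$ of a differential ring is $\det[D^{(r)}(y_s)]_{0\le r\le N-1,\,1\le s\le N}$. Here $\mathbb{T}_k$ is enumerated according to a fixed term order on the set of all monomials in the $t_i$ and the $X_{ij}$ (the order affects the wronskian only by a sign). The specialization $Y_{ij}\mapsto f_{ij}$ is the differential $F$-algebra homomorphism $F\{Y_{ij}\}[X_{ij}]\to F(X_{ij})$ sending $Y_{ij}$ to $f_{ij}$ (hence the $r$-th derivative of $Y_{ij}$ to that of $f_{ij}$) and $X_{ij}$ to $X_{ij}$. A Picard-Vessiot extension $E\supseteq F$ is a differential field extension that is generated as a differential field over $F$ by the full set $V$ of solutions in $E$ of a monic linear homogeneous differential equation over $F$ of order $\dim_C V$, and that has no new constants. It is for $\mathrm{GL}_n(C)$ if its group of differential automorphisms over $F$ is $\mathrm{GL}_n(C)$, here acting on $F(X_{ij})$ by fixing $F$ and by right multiplication on the matrix $[X_{ij}]$. *)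

theory Defs
  imports
    "HOL-Analysis.Analysis"
    "HOL-Library.Poly_Mapping"
    "HOL-Library.Countable"
    "HOL-Algebra.Group"
    "Jordan_Normal_Form.Determinant"
begin

section \<open>Subfields and polynomials\<close>

definition is_subring :: "'a::ring_1 set \<Rightarrow> bool" where
  "is_subring R \<longleftrightarrow> 0 \<in> R \<and> 1 \<in> R \<and>
     (\<forall>x\<in>R. \<forall>y\<in>R. x + y \<in> R \<and> x * y \<in> R) \<and> (\<forall>x\<in>R. - x \<in> R)"

definition is_subfield :: "'a::field set \<Rightarrow> bool" where
  "is_subfield K \<longleftrightarrow> is_subring K \<and> (\<forall>x\<in>K. inverse x \<in> K)"

definition alg_closed_on :: "'a::field set \<Rightarrow> bool" where
  "alg_closed_on K \<longleftrightarrow>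
     (\<forall>p. (\<forall>i. coeff p i \<in> K) \<and> degree p > 0 \<longrightarrow> (\<exists>x\<in>K. poly p x = 0))"

definition algebraic_over :: "'a::field set \<Rightarrow> 'a \<Rightarrow> bool" where
  "algebraic_over K x \<longleftrightarrow> (\<exists>p. p \<noteq> 0 \<and> (\<forall>i. coeff p i \<in> K) \<and> poly p x = 0)"

text \<open>A polynomial in variables from \<open>'v\<close> maps exponent vectors \<open>'v \<Rightarrow>\<^sub>0 nat\<close> to coefficients.\<close>

type_synonym ('v, 'a) mpol = "('v \<Rightarrow>\<^sub>0 nat) \<Rightarrow>\<^sub>0 'a"

definition mconst :: "'a::zero \<Rightarrow> ('v, 'a) mpol" where
  "mconst c = Poly_Mapping.single 0 c"

definition mvar :: "'v \<Rightarrow> ('v, 'a::zero_neq_one) mpol" where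
  "mvar v = Poly_Mapping.single (Poly_Mapping.single v 1) 1"

definition monom_val :: "('v \<Rightarrow> 'b::comm_ring_1) \<Rightarrow> ('v \<Rightarrow>\<^sub>0 nat) \<Rightarrow> 'b" where
  "monom_val \<rho> e = (\<Prod>v\<in>Poly_Mapping.keys e. \<rho> v ^ Poly_Mapping.lookup e v)"

text \<open>Evaluation: \<open>\<phi>\<close> is applied to the coefficients, \<open>\<rho>\<close> assigns values to the variables.\<close>

definition mpol_eval ::
  "('a::zero \<Rightarrow> 'b::comm_ring_1) \<Rightarrow> ('v \<Rightarrow> 'b) \<Rightarrow> ('v, 'a) mpol \<Rightarrow> 'b" where
  "mpol_eval \<phi> \<rho> p =
     (\<Sum>e\<in>Poly_Mapping.keys p. \<phi> (Poly_Mapping.lookup p e) * monom_val \<rho> e)"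

definition alg_independent :: "'a::field set \<Rightarrow> 'v set \<Rightarrow> ('v \<Rightarrow> 'a) \<Rightarrow> bool" where
  "alg_independent K I t \<longleftrightarrow>
     (\<forall>p. (\<forall>e. Poly_Mapping.lookup p e \<in> K) \<and>
          (\<forall>e\<in>Poly_Mapping.keys p. Poly_Mapping.keys e \<subseteq> I) \<and>
          mpol_eval (\<lambda>c. c) t p = 0 \<longrightarrow> p = 0)"


section \<open>Derivations\<close>

definition derivation :: "('a::ring \<Rightarrow> 'a) \<Rightarrow> bool" where
  "derivation D \<longleftrightarrow> (\<forall>x y. D (x + y) = D x + D y) \<and> (\<forall>x y. D (x * y) = D x * y + x * D y)"

definition constants :: "('a::zero \<Rightarrow> 'a) \<Rightarrow> 'a set" where
  "constants D = {c. D c = 0}"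

definition diff_subfield :: "('a::field \<Rightarrow> 'a) \<Rightarrow> 'a set \<Rightarrow> bool" where
  "diff_subfield D K \<longleftrightarrow> is_subfield K \<and> (\<forall>x\<in>K. D x \<in> K)"

definition wronskian :: "('a::comm_ring_1 \<Rightarrow> 'a) \<Rightarrow> 'a list \<Rightarrow> 'a" where
  "wronskian D ys =
     Determinant.det (mat (length ys) (length ys) (\<lambda>(r, s). (D ^^ r) (ys ! s)))"

text \<open>
  The derivation of a polynomial ring that restricts to the derivation \<open>d\<close> of the coefficients
  and maps each variable \<open>v\<close> to \<open>g v\<close>:
  \<open>D (\<Sum> c\<^sub>e x\<^sup>e) = \<Sum> (d c\<^sub>e) x\<^sup>e + \<Sum> c\<^sub>e (\<partial>x\<^sup>e/\<partial>v) g v\<close>; see \<open>derivation_mpol_deriv\<close>,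
  \<open>mpol_deriv_mconst\<close> and \<open>mpol_deriv_mvar\<close> below.
\<close>

definition mpol_deriv ::
  "('a::comm_ring_1 \<Rightarrow> 'a) \<Rightarrow> ('v \<Rightarrow> ('v, 'a) mpol) \<Rightarrow> ('v, 'a) mpol \<Rightarrow> ('v, 'a) mpol" where
  "mpol_deriv d g p =
     (\<Sum>e\<in>Poly_Mapping.keys p. Poly_Mapping.single e (d (Poly_Mapping.lookup p e)) +
        (\<Sum>v\<in>Poly_Mapping.keys e.
           Poly_Mapping.single (e - Poly_Mapping.single v 1)
             (of_nat (Poly_Mapping.lookup e v) * Poly_Mapping.lookup p e) * g v))"


section \<open>Picard-Vessiot extensions\<close>

definition has_dim :: "'a::field set \<Rightarrow> 'a set \<Rightarrow> nat \<Rightarrow> bool" where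
  "has_dim K V N \<longleftrightarrow> (\<exists>b :: nat \<Rightarrow> 'a.
     (\<forall>i<N. b i \<in> V) \<and>
     (\<forall>c. (\<forall>i<N. c i \<in> K) \<and> (\<Sum>i<N. c i * b i) = 0 \<longrightarrow> (\<forall>i<N. c i = 0)) \<and>
     (\<forall>v\<in>V. \<exists>c. (\<forall>i<N. c i \<in> K) \<and> v = (\<Sum>i<N. c i * b i)))"

text \<open>The solutions of \<open>y\<^sup>(\<^sup>N\<^sup>) + a\<^sub>N\<^sub>-\<^sub>1 y\<^sup>(\<^sup>N\<^sup>-\<^sup>1\<^sup>) + \<dots> + a\<^sub>0 y = 0\<close>.\<close>

definition lin_ode_solutions :: "('a::field \<Rightarrow> 'a) \<Rightarrow> nat \<Rightarrow> (nat \<Rightarrow> 'a) \<Rightarrow> 'a set" where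
  "lin_ode_solutions D N a = {y. (D ^^ N) y + (\<Sum>i<N. a i * (D ^^ i) y) = 0}"

text \<open>The ambient differential field is the whole type, with derivation \<open>D\<close>; \<open>F\<close> is the base
  field, whose field of constants is \<open>constants D \<inter> F\<close>.\<close>

definition picard_vessiot :: "('a::field \<Rightarrow> 'a) \<Rightarrow> 'a set \<Rightarrow> bool" where
  "picard_vessiot D F \<longleftrightarrow>
     derivation D \<and> diff_subfield D F \<and> constants D \<subseteq> F \<and>
     (\<exists>N a. (\<forall>i<N. a i \<in> F) \<and>
        has_dim (constants D \<inter> F) (lin_ode_solutions D N a) N \<and>
        diff_subfield D hull (F \<union> lin_ode_solutions D N a) = UNIV)"

definition diff_aut_group :: "('a::field \<Rightarrow> 'a) \<Rightarrow> 'a set \<Rightarrow> ('a \<Rightarrow> 'a) monoid" where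
  "diff_aut_group D F =
     \<lparr>carrier = {\<sigma>. bij \<sigma> \<and> \<sigma> 1 = 1 \<and> (\<forall>x y. \<sigma> (x + y) = \<sigma> x + \<sigma> y) \<and>
                   (\<forall>x y. \<sigma> (x * y) = \<sigma> x * \<sigma> y) \<and> (\<forall>x. \<sigma> (D x) = D (\<sigma> x)) \<and>
                   (\<forall>x\<in>F. \<sigma> x = x)},
      mult = (\<circ>), one = id\<rparr>"

definition mats_over :: "'a set \<Rightarrow> ('a ^ 'n ^ 'n) set" where
  "mats_over K = {M. \<forall>i j. M $ i $ j \<in> K}"

definition GL_group :: "'a::field set \<Rightarrow> ('a ^ 'n ^ 'n) monoid" where
  "GL_group K =
     \<lparr>carrier = {M \<in> mats_over K. \<exists>M'\<in>mats_over K.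
                   M ** M' = Finite_Cartesian_Product.mat 1 \<and>
                   M' ** M = Finite_Cartesian_Product.mat 1},
      mult = (**), one = Finite_Cartesian_Product.mat 1\<rparr>"

text \<open>Picard-Vessiot with group \<open>GL\<^sub>n\<close> of the constants, acting by right multiplication on the
  matrix \<open>X\<close>.\<close>

definition picard_vessiot_GL :: "('a::field \<Rightarrow> 'a) \<Rightarrow> 'a set \<Rightarrow> 'a ^ 'n ^ 'n \<Rightarrow> bool" where
  "picard_vessiot_GL D F X \<longleftrightarrow> picard_vessiot D F \<and>
     (\<exists>\<Phi> \<in> iso (GL_group (constants D \<inter> F) :: ('a ^ 'n ^ 'n) monoid) (diff_aut_group D F).
        \<forall>M \<in> carrier (GL_group (constants D \<inter> F)). \<forall>i j. \<Phi> M (X $ i $ j) = (X ** M) $ i $ j)"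


section \<open>The field of rational functions in the \<open>X\<^sub>i\<^sub>j\<close>\<close>

datatype 'n xvar = XVar 'n 'n

instance xvar :: (countable) countable
  by countable_datatype

text \<open>Integral domain instances for \<open>mpol\<close> require linearly ordered variables; which order is
  used is immaterial.\<close>

instantiation xvar :: (countable) linorder
begin
definition less_eq_xvar :: "'a xvar \<Rightarrow> 'a xvar \<Rightarrow> bool" where
  "less_eq_xvar x y \<longleftrightarrow> to_nat x \<le> to_nat y"
definition less_xvar :: "'a xvar \<Rightarrow> 'a xvar \<Rightarrow> bool" where
  "less_xvar x y \<longleftrightarrow> to_nat x < to_nat y"
instance
  by standard (auto simp: less_eq_xvar_def less_xvar_def)
end

type_synonym ('n, 'a) ratfun = "('n xvar, 'a) mpol fract"

definition rconst :: "'a \<Rightarrow> ('n::finite, 'a::field) ratfun" where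
  "rconst c = to_fract (mconst c)"

definition rX :: "'n \<Rightarrow> 'n \<Rightarrow> ('n::finite, 'a::field) ratfun" where
  "rX i j = to_fract (mvar (XVar i j))"


section \<open>The differential ring \<open>F{Y\<^sub>i\<^sub>j}[X\<^sub>i\<^sub>j]\<close> and the wronskians \<open>W\<^sub>k\<close>\<close>

text \<open>\<open>(i, j, r)\<close> stands for the \<open>r\<close>-th derivative of \<open>Y\<^sub>i\<^sub>j\<close>.\<close>

type_synonym ('n, 'a) diffpol = "('n \<times> 'n \<times> nat, 'a) mpol"

definition diffpol_deriv ::
  "('a::field \<Rightarrow> 'a) \<Rightarrow> ('n, 'a) diffpol \<Rightarrow> ('n, 'a) diffpol" where
  "diffpol_deriv d = mpol_deriv d (\<lambda>(i, j, r). mvar (i, j, Suc r))"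

definition diffpolX_deriv ::
  "('a::field \<Rightarrow> 'a) \<Rightarrow> ('n::finite xvar, ('n, 'a) diffpol) mpol \<Rightarrow> ('n xvar, ('n, 'a) diffpol) mpol"
  where
  "diffpolX_deriv d = mpol_deriv (diffpol_deriv d)
     (\<lambda>x. case x of XVar i j \<Rightarrow> \<Sum>l\<in>UNIV. mconst (mvar (i, l, 0)) * mvar (XVar l j))"

text \<open>Monomials in \<open>t\<^sub>0, \<dots>, t\<^sub>m\<^sub>-\<^sub>1\<close> and the \<open>X\<^sub>i\<^sub>j\<close>, as exponent vectors.\<close>

type_synonym 'n tXmonom = "(nat + 'n xvar) \<Rightarrow>\<^sub>0 nat"

definition tX_monoms :: "nat \<Rightarrow> 'n tXmonom set" where
  "tX_monoms m = {e. Poly_Mapping.keys e \<subseteq> Inl ` {..<m} \<union> range Inr}"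

definition tX_monoms_le :: "nat \<Rightarrow> nat \<Rightarrow> 'n tXmonom set" where
  "tX_monoms_le m k =
     {e \<in> tX_monoms m. (\<Sum>v\<in>Poly_Mapping.keys e. Poly_Mapping.lookup e v) \<le> k}"

definition tX_val ::
  "(nat \<Rightarrow> 'a::field) \<Rightarrow> 'n tXmonom \<Rightarrow> ('n xvar, ('n, 'a) diffpol) mpol" where
  "tX_val t = monom_val (\<lambda>v. case v of Inl i \<Rightarrow> mconst (mconst (t i)) | Inr x \<Rightarrow> mvar x)"

definition term_order_on :: "('v \<Rightarrow>\<^sub>0 nat) set \<Rightarrow> (('v \<Rightarrow>\<^sub>0 nat) \<Rightarrow> ('v \<Rightarrow>\<^sub>0 nat) \<Rightarrow> bool) \<Rightarrow> bool" where
  "term_order_on S mle \<longleftrightarrow>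
     (\<forall>a\<in>S. mle a a) \<and>
     (\<forall>a\<in>S. \<forall>b\<in>S. mle a b \<and> mle b a \<longrightarrow> a = b) \<and>
     (\<forall>a\<in>S. \<forall>b\<in>S. \<forall>c\<in>S. mle a b \<and> mle b c \<longrightarrow> mle a c) \<and>
     (\<forall>a\<in>S. \<forall>b\<in>S. mle a b \<or> mle b a) \<and>
     (\<forall>a\<in>S. mle 0 a) \<and>
     (\<forall>a\<in>S. \<forall>b\<in>S. \<forall>c\<in>S. mle a b \<longrightarrow> mle (a + c) (b + c))"

text \<open>The increasing enumeration of a finite set.\<close>

definition enum_by :: "('b \<Rightarrow> 'b \<Rightarrow> bool) \<Rightarrow> 'b set \<Rightarrow> 'b list" where
  "enum_by mle S = (THE xs. set xs = S \<and> sorted_wrt (\<lambda>a b. mle a b \<and> a \<noteq> b) xs)"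

definition Wk ::
  "('a::field \<Rightarrow> 'a) \<Rightarrow> nat \<Rightarrow> (nat \<Rightarrow> 'a) \<Rightarrow> ('n::finite tXmonom \<Rightarrow> 'n tXmonom \<Rightarrow> bool) \<Rightarrow>
    nat \<Rightarrow> ('n xvar, ('n, 'a) diffpol) mpol" where
  "Wk d m t mle k =
     wronskian (diffpolX_deriv d) (map (tX_val t) (enum_by mle (tX_monoms_le m k)))"

definition specialize ::
  "('a::field \<Rightarrow> 'a) \<Rightarrow> ('n::finite \<Rightarrow> 'n \<Rightarrow> 'a) \<Rightarrow> ('n xvar, ('n, 'a) diffpol) mpol \<Rightarrow>
    ('n, 'a) ratfun" where
  "specialize d f =
     mpol_eval (mpol_eval rconst (\<lambda>(i, j, r). rconst ((d ^^ r) (f i j))))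
       (\<lambda>x. case x of XVar i j \<Rightarrow> rX i j)"


section \<open>The derivations are well defined\<close>

lemma derivation_zero: "derivation D \<Longrightarrow> D 0 = 0"
  unfolding derivation_def by (metis add.right_neutral add_left_cancel)

lemma derivation_one: "derivation D \<Longrightarrow> D (1 :: 'a::ring_1) = 0"
  unfolding derivation_def by (metis add.right_neutral add_left_cancel mult_1 mult_1_right)

lemma derivation_sum:
  assumes "derivation D"
  shows "D (sum h A) = (\<Sum>x\<in>A. D (h x))"
proof (induction A rule: infinite_finite_induct)
  case (insert x A)
  then show ?case using assms by (simp add: derivation_def)
qed (use derivation_zero[OF assms] in auto)

lemma mpol_sum_single:
  "(\<Sum>e\<in>Poly_Mapping.keys p. Poly_Mapping.single e (Poly_Mapping.lookup p e)) = p"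
proof (rule poly_mapping_eqI)
  fix k
  show "Poly_Mapping.lookup (\<Sum>e\<in>Poly_Mapping.keys p. Poly_Mapping.single e (Poly_Mapping.lookup p e)) k
      = Poly_Mapping.lookup p k"
    by (auto simp: lookup_sum lookup_single when_def sum.delta in_keys_iff)
qed

lemma mpol_deriv_superset:
  assumes "derivation d" "finite A" "Poly_Mapping.keys p \<subseteq> A"
  shows "mpol_deriv d g p =
     (\<Sum>e\<in>A. Poly_Mapping.single e (d (Poly_Mapping.lookup p e)) +
        (\<Sum>v\<in>Poly_Mapping.keys e.
           Poly_Mapping.single (e - Poly_Mapping.single v 1)
             (of_nat (Poly_Mapping.lookup e v) * Poly_Mapping.lookup p e) * g v))"
  unfolding mpol_deriv_def
  by (rule sum.mono_neutral_left) (use assms in \<open>auto simp: in_keys_iff derivation_zero\<close>)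

lemma mpol_deriv_single:
  assumes "derivation d"
  shows "mpol_deriv d g (Poly_Mapping.single e c) = Poly_Mapping.single e (d c) +
    (\<Sum>v\<in>Poly_Mapping.keys e. Poly_Mapping.single (e - Poly_Mapping.single v 1)
       (of_nat (Poly_Mapping.lookup e v) * c) * g v)"
  using mpol_deriv_superset[OF assms, of "{e}" "Poly_Mapping.single e c" g]
  by (simp add: keys_single)

lemma mpol_deriv_add:
  assumes "derivation d"
  shows "mpol_deriv d g (p + q) = mpol_deriv d g p + mpol_deriv d g q"
proof -
  let ?A = "Poly_Mapping.keys p \<union> Poly_Mapping.keys q"
  have sub: "Poly_Mapping.keys (p + q) \<subseteq> ?A" by (rule keys_add)
  have da: "d (x + y) = d x + d y" for x y using assms by (simp add: derivation_def)
  show ?thesis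
    by (subst (1 2 3) mpol_deriv_superset[OF assms, of ?A])
       (use sub in \<open>auto simp: lookup_add da single_add distrib_left distrib_right
           sum.distrib algebra_simps\<close>)
qed

lemma mpol_deriv_sum:
  assumes "derivation d"
  shows "mpol_deriv d g (sum h A) = (\<Sum>x\<in>A. mpol_deriv d g (h x))"
proof (induction A rule: infinite_finite_induct)
  case (insert x A)
  then show ?case by (simp add: mpol_deriv_add[OF assms])
qed (simp_all add: mpol_deriv_def)

lemma mpol_deriv_single_superset:
  assumes "derivation d" "finite V" "Poly_Mapping.keys e \<subseteq> V"
  shows "mpol_deriv d g (Poly_Mapping.single e c) = Poly_Mapping.single e (d c) +
    (\<Sum>v\<in>V. Poly_Mapping.single (e - Poly_Mapping.single v 1)
       (of_nat (Poly_Mapping.lookup e v) * c) * g v)"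
  unfolding mpol_deriv_single[OF assms(1)]
  by (rule arg_cong2[where f = "(+)"], simp, rule sum.mono_neutral_left)
     (use assms in \<open>auto simp: in_keys_iff\<close>)

lemma single_minus_add:
  fixes a :: "'a::comm_ring_1" and e e' :: "'v \<Rightarrow>\<^sub>0 nat"
  shows "Poly_Mapping.single (e + e' - Poly_Mapping.single v 1) (of_nat (Poly_Mapping.lookup e v) * a) =
         Poly_Mapping.single (e - Poly_Mapping.single v 1 + e') (of_nat (Poly_Mapping.lookup e v) * a)"
proof (cases "Poly_Mapping.lookup e v = 0")
  case False
  have "e + e' - Poly_Mapping.single v 1 = e - Poly_Mapping.single v 1 + e'"
    by (rule poly_mapping_eqI) (use False in \<open>auto simp: lookup_add lookup_minus lookup_single when_def\<close>)
  then show ?thesis by simp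
qed simp

lemma mpol_deriv_mult_single:
  assumes "derivation d"
  shows "mpol_deriv d g (Poly_Mapping.single e c * Poly_Mapping.single e' c') =
    mpol_deriv d g (Poly_Mapping.single e c) * Poly_Mapping.single e' c' +
    Poly_Mapping.single e c * mpol_deriv d g (Poly_Mapping.single e' c')"
proof -
  let ?V = "Poly_Mapping.keys e \<union> Poly_Mapping.keys e'"
  let ?s = "\<lambda>v. Poly_Mapping.single v (1::nat)"
  have k: "Poly_Mapping.keys (e + e') \<subseteq> ?V" by (rule keys_add)
  have dm: "d (c * c') = d c * c' + c * d c'" using assms by (simp add: derivation_def)
  have *: "Poly_Mapping.single (e + e' - ?s v) (of_nat (Poly_Mapping.lookup (e + e') v) * (c * c')) * g v =
      Poly_Mapping.single (e - ?s v) (of_nat (Poly_Mapping.lookup e v) * c) * g v * Poly_Mapping.single e' c' +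
      Poly_Mapping.single e c * (Poly_Mapping.single (e' - ?s v) (of_nat (Poly_Mapping.lookup e' v) * c') * g v)" for v
  proof -
    have "Poly_Mapping.single (e + e' - ?s v) (of_nat (Poly_Mapping.lookup (e + e') v) * (c * c')) =
       Poly_Mapping.single (e + e' - ?s v) (of_nat (Poly_Mapping.lookup e v) * (c * c')) +
       Poly_Mapping.single (e' + e - ?s v) (of_nat (Poly_Mapping.lookup e' v) * (c * c'))"
      by (simp add: lookup_add distrib_right single_add add.commute)
    also have "\<dots> = Poly_Mapping.single (e - ?s v + e') (of_nat (Poly_Mapping.lookup e v) * (c * c')) +
       Poly_Mapping.single (e' - ?s v + e) (of_nat (Poly_Mapping.lookup e' v) * (c * c'))"
      by (simp only: single_minus_add)
    also have "\<dots> = Poly_Mapping.single (e - ?s v) (of_nat (Poly_Mapping.lookup e v) * c) * Poly_Mapping.single e' c' +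
       Poly_Mapping.single e c * Poly_Mapping.single (e' - ?s v) (of_nat (Poly_Mapping.lookup e' v) * c')"
      by (simp add: mult_single ac_simps)
    finally show ?thesis by (simp add: distrib_right distrib_left mult_ac)
  qed
  show ?thesis
    unfolding mult_single
    by (subst (1 2 3) mpol_deriv_single_superset[OF assms, of ?V])
       (use k in \<open>auto simp: * dm single_add mult_single sum.distrib distrib_left distrib_right
          sum_distrib_left sum_distrib_right simp del: single_of_nat One_nat_def\<close>)
qed

lemma derivation_mpol_deriv:
  assumes "derivation d"
  shows "derivation (mpol_deriv d g)"
proof -
  have "mpol_deriv d g (p * q) = mpol_deriv d g p * q + p * mpol_deriv d g q" for p q
  proof -
    let ?s = "\<lambda>p e. Poly_Mapping.single e (Poly_Mapping.lookup p e)"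
    let ?P = "Poly_Mapping.keys p" and ?Q = "Poly_Mapping.keys q"
    have "p * q = (\<Sum>e\<in>?P. \<Sum>e'\<in>?Q. ?s p e * ?s q e')"
      by (simp only: sum_product[symmetric] mpol_sum_single)
    then have "mpol_deriv d g (p * q) =
        (\<Sum>e\<in>?P. \<Sum>e'\<in>?Q. mpol_deriv d g (?s p e) * ?s q e' + ?s p e * mpol_deriv d g (?s q e'))"
      by (simp only: mpol_deriv_sum[OF assms] mpol_deriv_mult_single[OF assms])
    also have "\<dots> = mpol_deriv d g (\<Sum>e\<in>?P. ?s p e) * (\<Sum>e'\<in>?Q. ?s q e') +
        (\<Sum>e\<in>?P. ?s p e) * mpol_deriv d g (\<Sum>e'\<in>?Q. ?s q e')"
      by (simp only: mpol_deriv_sum[OF assms] sum_product sum.distrib)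
    finally show ?thesis by (simp only: mpol_sum_single)
  qed
  then show ?thesis unfolding derivation_def by (intro conjI allI mpol_deriv_add[OF assms])
qed

lemma mpol_deriv_mconst:
  "derivation d \<Longrightarrow> mpol_deriv d g (mconst c) = mconst (d c)"
  by (simp add: mconst_def mpol_deriv_single)

lemma mpol_deriv_mvar:
  "derivation d \<Longrightarrow> mpol_deriv d g (mvar v) = g v"
  by (simp add: mvar_def mpol_deriv_single derivation_one)

lemma derivation_diffpol_deriv: "derivation d \<Longrightarrow> derivation (diffpol_deriv d)"
  unfolding diffpol_deriv_def by (rule derivation_mpol_deriv)

lemma diffpol_deriv_Y:
  "derivation d \<Longrightarrow> diffpol_deriv d (mvar (i, j, r)) = mvar (i, j, Suc r)"
  unfolding diffpol_deriv_def by (simp add: mpol_deriv_mvar)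

lemma derivation_diffpolX_deriv: "derivation d \<Longrightarrow> derivation (diffpolX_deriv d)"
  unfolding diffpolX_deriv_def by (intro derivation_mpol_deriv derivation_diffpol_deriv)

lemma diffpolX_deriv_mconst:
  "derivation d \<Longrightarrow> diffpolX_deriv d (mconst p) = mconst (diffpol_deriv d p)"
  unfolding diffpolX_deriv_def by (intro mpol_deriv_mconst derivation_diffpol_deriv)

lemma diffpolX_deriv_X:
  "derivation d \<Longrightarrow> diffpolX_deriv d (mvar (XVar i j)) =
     (\<Sum>l\<in>UNIV. mconst (mvar (i, l, 0)) * mvar (XVar l j))"
  unfolding diffpolX_deriv_def by (simp add: mpol_deriv_mvar derivation_diffpol_deriv)

lemma derivation_fract_exists:
  fixes d :: "'a::idom \<Rightarrow> 'a"
  assumes "derivation d"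
  shows "\<exists>D. derivation D \<and> (\<forall>a. D (to_fract a) = to_fract (d a))"
proof -
  define R where "R x y \<longleftrightarrow> (\<exists>a b. b \<noteq> 0 \<and> x = Fract a b \<and> y = Fract (d a * b - a * d b) (b * b))"
    for x y
  define D where "D x = (SOME y. R x y)" for x
  have add: "d (x + y) = d x + d y" and mult: "d (x * y) = d x * y + x * d y" for x y
    using assms by (auto simp: derivation_def)
  have D: "D (Fract a b) = Fract (d a * b - a * d b) (b * b)" if b: "b \<noteq> 0" for a b
  proof -
    have "R (Fract a b) (D (Fract a b))"
      unfolding D_def by (rule someI) (use b in \<open>auto simp: R_def\<close>)
    then obtain a' b' where b': "b' \<noteq> 0" "Fract a b = Fract a' b'"
      and Dv: "D (Fract a b) = Fract (d a' * b' - a' * d b') (b' * b')"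
      unfolding R_def by auto
    have eq: "a * b' = a' * b" using b b' by (simp add: eq_fract)
    then have "d (a * b') = d (a' * b)" by simp
    then have deq: "d a * b' + a * d b' = d a' * b + a' * d b" by (simp add: mult)
    have "(d a' * b' - a' * d b') * (b * b) - (d a * b - a * d b) * (b' * b') =
        b * b' * (d a' * b + a' * d b - (d a * b' + a * d b')) +
        (b' * d b + b * d b') * (a * b' - a' * b)"
      by (simp add: algebra_simps)
    also have "\<dots> = 0" using eq deq by simp
    finally show ?thesis unfolding Dv using b b' by (simp add: eq_fract)
  qed
  have "derivation D"
    unfolding derivation_def
  proof (intro conjI allI)
    fix x y :: "'a fract"
    obtain a b where x: "x = Fract a b" "b \<noteq> 0" by (cases x) auto
    obtain a' b' where y: "y = Fract a' b'" "b' \<noteq> 0" by (cases y) auto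
    show "D (x + y) = D x + D y"
      using x(2) y(2) unfolding x y
      by (simp add: D eq_fract add mult) (simp add: algebra_simps)
    show "D (x * y) = D x * y + x * D y"
      using x(2) y(2) unfolding x y
      by (simp add: D eq_fract add mult) (simp add: algebra_simps)
  qed
  moreover have "D (to_fract a) = to_fract (d a)" for a
    using derivation_one[OF assms] by (simp add: to_fract_def D)
  ultimately show ?thesis by blast
qed

lemma ratfun_derivation_exists:
  fixes f :: "'n::finite \<Rightarrow> 'n \<Rightarrow> 'a::field"
  assumes "derivation d"
  shows "\<exists>D. derivation D \<and> (\<forall>a. D (rconst a) = rconst (d a)) \<and>
    (\<forall>i j. D (rX i j) = (\<Sum>l\<in>UNIV. rconst (f i l) * rX l j))"
proof -
  let ?g = "\<lambda>x. case x of XVar i j \<Rightarrow> \<Sum>l\<in>UNIV. mconst (f i l) * mvar (XVar l j)"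
  obtain D where D: "derivation D" "\<And>a. D (to_fract a) = to_fract (mpol_deriv d ?g a)"
    using derivation_fract_exists[OF derivation_mpol_deriv[OF assms]] by blast
  have "to_fract (sum h A) = (\<Sum>x\<in>A. to_fract (h x))"
    for h :: "'n \<Rightarrow> ('n xvar, 'a) mpol" and A
    by (induction A rule: infinite_finite_induct) auto
  then show ?thesis
    using D assms by (intro exI[of _ D]) (auto simp: rconst_def rX_def mpol_deriv_mconst mpol_deriv_mvar)
qed

end

theory Submission
  imports Defs
begin

text \<open>
  Over a differential field a wronskian vanishes exactly when its entries are linearly dependent
  over the constants.  Hence the specialized wronskians are all nonzero if and only if the \<open>t\<^sub>i\<close> and
  the \<open>X\<^sub>i\<^sub>j\<close> are algebraically independent over the constants of \<open>F(X\<^sub>i\<^sub>j)\<close>.  If there are no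
  constants outside \<open>F\<close>, this is clear.  Conversely, every element of \<open>F(X\<^sub>i\<^sub>j)\<close> is algebraic
  over \<open>C(t\<^sub>i, X\<^sub>i\<^sub>j)\<close>; for a constant, independence over the constants turns the algebraic relation
  into one over the algebraically closed field \<open>C\<close>, so the constant lies in \<open>C\<close>.

  Without new constants, \<open>F(X\<^sub>i\<^sub>j)\<close> is always a Picard-Vessiot extension: the span of the \<open>X\<^sub>i\<^sub>j\<close> over
  the constants is the solution space of a linear equation of order \<open>n\<^sup>2\<close> over \<open>F\<close>, and for a
  differential automorphism \<open>\<sigma>\<close> the matrix \<open>X\<^sup>-\<^sup>1 \<sigma>(X)\<close> has constant entries.
\<close>

section \<open>Subrings, subfields and derivations\<close>

text \<open>The wronskian criterion yields dependence only over the constants of the field in which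
  the wronskian lives. Here that field is \<open>F(X_ij)\<close>, whose constants are exactly what
  is in question. Independence over \<open>C\<close> itself always holds, since the
  \<open>X_ij\<close> are variables over \<open>F\<close> and the \<open>t_i\<close> are independent
  over \<open>C\<close>. The content of the wronskian condition is that this independence survives
  the passage from \<open>C\<close> to all constants of \<open>D\<close>.

  The \<open>t_i\<close> belong among the monomials because the \<open>t_i\<close> and
  \<open>X_ij\<close> together form a transcendence basis of \<open>F(X_ij)\<close> over
  \<open>C\<close>; this brings the equation of a new constant down to coefficients in
  \<open>C\<close>.

  The matrix \<open>X\<close> is generic, so right multiplication by any invertible matrix over
  \<open>C\<close> is an automorphism. The group is therefore all of \<open>GL_n(C)\<close> as soon
  as no constant is new.

  The order \<open>n^2\<close> arises twice: as the dimension of the matrices over \<open>F\<close>,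
  which bounds the order from above, and as the number of independent solutions \<open>X_ij\<close>,
  which bounds it from below.

  Base fields are subsets of a type, so linear algebra and algebraic elements are treated relative
  to a subfield.\<close>

lemma is_subringD:
  assumes "is_subring R"
  shows is_subring_0: "0 \<in> R" and is_subring_1: "1 \<in> R"
    and is_subring_add: "x \<in> R \<Longrightarrow> y \<in> R \<Longrightarrow> x + y \<in> R"
    and is_subring_mult: "x \<in> R \<Longrightarrow> y \<in> R \<Longrightarrow> x * y \<in> R"
    and is_subring_uminus: "x \<in> R \<Longrightarrow> - x \<in> R"
  using assms by (auto simp: is_subring_def)

lemma is_subring_diff: "is_subring R \<Longrightarrow> x \<in> R \<Longrightarrow> y \<in> R \<Longrightarrow> x - y \<in> R"
  using is_subring_add[of R x "- y"] is_subring_uminus[of R y] by simp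

lemma is_subring_sum: "is_subring R \<Longrightarrow> (\<And>x. x \<in> A \<Longrightarrow> g x \<in> R) \<Longrightarrow> sum g A \<in> R"
  by (induction A rule: infinite_finite_induct) (auto intro: is_subringD)

lemma is_subring_power: "is_subring R \<Longrightarrow> x \<in> R \<Longrightarrow> x ^ n \<in> R"
  by (induction n) (auto intro: is_subringD)

lemma is_subfield_imp_subring: "is_subfield K \<Longrightarrow> is_subring K"
  by (simp add: is_subfield_def)

lemmas is_subfieldD = is_subringD[OF is_subfield_imp_subring]
lemmas is_subfield_sum = is_subring_sum[OF is_subfield_imp_subring]
lemmas is_subfield_diff = is_subring_diff[OF is_subfield_imp_subring]

lemma is_subfield_inverse: "is_subfield K \<Longrightarrow> x \<in> K \<Longrightarrow> inverse x \<in> K"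
  by (simp add: is_subfield_def)

lemma is_subfield_divide: "is_subfield K \<Longrightarrow> x \<in> K \<Longrightarrow> y \<in> K \<Longrightarrow> x / y \<in> K"
  by (simp add: is_subfield_inverse is_subfieldD divide_inverse)

lemma is_subfield_UNIV: "is_subfield UNIV"
  by (simp add: is_subfield_def is_subring_def)

lemma is_subfield_hull: "is_subfield (is_subfield hull S)"
  by (rule hull_in) (auto simp: is_subfield_def is_subring_def)

lemma derivation_inverse:
  fixes D :: "'a::field \<Rightarrow> 'a"
  assumes "derivation D"
  shows "D (inverse x) = - (D x) / x ^ 2"
proof (cases "x = 0")
  case False
  have "0 = D (x * inverse x)"
    using False derivation_one[OF assms] by simp
  also have "\<dots> = D x * inverse x + x * D (inverse x)"
    using assms unfolding derivation_def by blast
  finally show ?thesis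
    using False by (simp add: field_simps power2_eq_square eq_neg_iff_add_eq_0)
qed (simp add: derivation_zero[OF assms])

lemma derivation_uminus:
  fixes D :: "'a::ring \<Rightarrow> 'a"
  assumes "derivation D"
  shows "D (- x) = - D x"
  using assms derivation_zero[OF assms] unfolding derivation_def
  by (metis add.right_inverse eq_neg_iff_add_eq_0 add.commute)

lemma is_subfield_constants:
  fixes D :: "'a::field \<Rightarrow> 'a"
  assumes "derivation D"
  shows "is_subfield (constants D)"
  using assms derivation_zero[OF assms] derivation_one[OF assms]
    derivation_uminus[OF assms] derivation_inverse[OF assms]
  by (auto simp: is_subfield_def is_subring_def constants_def derivation_def)

text \<open>Gaussian elimination, one equation per induction step. Only field operations are applied
  to the coefficients, so the solution stays in the subfield \<open>L\<close>.\<close>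

lemma homogeneous_system_nontrivial_solution:
  fixes a :: "'u \<Rightarrow> 'j \<Rightarrow> 'a::field"
  assumes L: "is_subfield L" and "finite J" "finite U" "card J < card U"
    and "\<And>u j. u \<in> U \<Longrightarrow> j \<in> J \<Longrightarrow> a u j \<in> L"
  shows "\<exists>x. (\<forall>u\<in>U. x u \<in> L) \<and> (\<exists>u\<in>U. x u \<noteq> 0) \<and> (\<forall>j\<in>J. (\<Sum>u\<in>U. x u * a u j) = 0)"
  using assms(2-5)
proof (induction J arbitrary: U a rule: finite_induct)
  case empty
  then show ?case
    by (intro exI[of _ "\<lambda>_. 1"]) (use L is_subfieldD in \<open>auto simp: card_gt_0_iff\<close>)
next
  case (insert j0 J U a)
  show ?case
  proof (cases "\<forall>u\<in>U. a u j0 = 0")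
    case True
    with insert.IH[of U a] insert.prems insert.hyps show ?thesis by auto
  next
    case False
    then obtain u0 where u0: "u0 \<in> U" "a u0 j0 \<noteq> 0" by blast
    define U' where "U' = U - {u0}"
    \<comment> \<open>Coefficients left after eliminating the unknown \<open>u0\<close> by means of
      equation \<open>j0\<close>; \<open>- s\<close> below is the value which that equation forces
      on \<open>u0\<close>.\<close>
    define b where "b u j = a u j - a u j0 / a u0 j0 * a u0 j" for u j
    have U: "U = insert u0 U'" "u0 \<notin> U'" "finite U'" using u0 insert.prems by (auto simp: U'_def)
    have "card J < card U'" using insert U by simp
    moreover have "b u j \<in> L" if "u \<in> U'" "j \<in> J" for u j
      unfolding b_def using that U insert.prems(3) L
      by (auto intro!: is_subfield_diff is_subfieldD is_subfield_divide)
    ultimately obtain x where x: "\<forall>u\<in>U'. x u \<in> L" "\<exists>u\<in>U'. x u \<noteq> 0"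
      "\<forall>j\<in>J. (\<Sum>u\<in>U'. x u * b u j) = 0"
      using insert.IH[of U' b] U by blast
    define s where "s = (\<Sum>u\<in>U'. x u * (a u j0 / a u0 j0))"
    define y where "y u = (if u = u0 then - s else x u)" for u
    have sL: "s \<in> L"
      unfolding s_def using x(1) insert.prems(3) U L
      by (auto intro!: is_subfield_sum is_subfieldD is_subfield_divide)
    have sum: "(\<Sum>u\<in>U. y u * a u j) = (\<Sum>u\<in>U'. x u * a u j) - s * a u0 j" for j
    proof -
      have "(\<Sum>u\<in>U. y u * a u j) = y u0 * a u0 j + (\<Sum>u\<in>U'. y u * a u j)"
        unfolding U(1) using U by simp
      also have "(\<Sum>u\<in>U'. y u * a u j) = (\<Sum>u\<in>U'. x u * a u j)"
        by (rule sum.cong) (use U in \<open>auto simp: y_def\<close>)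
      finally show ?thesis by (simp add: y_def)
    qed
    have 1: "(\<Sum>u\<in>U. y u * a u j0) = 0"
      unfolding sum using u0 by (simp add: s_def sum_distrib_right)
    have 2: "(\<Sum>u\<in>U. y u * a u j) = 0" if "j \<in> J" for j
    proof -
      have "(\<Sum>u\<in>U. y u * a u j) = (\<Sum>u\<in>U'. x u * b u j)"
        unfolding sum s_def b_def
        by (simp add: sum_distrib_right sum_subtractf right_diff_distrib mult.assoc)
      then show ?thesis using x(3) that by simp
    qed
    have 3: "\<forall>u\<in>U. y u \<in> L" using x(1) sL L U by (auto simp: y_def intro: is_subfieldD)
    have "\<exists>u\<in>U. y u \<noteq> 0" using x(2) U by (auto simp: y_def)
    with 1 2 3 show ?thesis by (intro exI[of _ y]) simp
  qed
qed

section \<open>Algebraic elements\<close>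

text \<open>A finitely generated module over the subfield that contains \<open>1\<close> and is stable under
  multiplication by \<open>u\<close> contains all powers of \<open>u\<close>.\<close>

lemma algebraic_over_stable:
  fixes u :: "'a::field" and w :: "'j \<Rightarrow> 'a"
  assumes L: "is_subfield L" and J: "finite J"
    and one: "j0 \<in> J" "w j0 = 1"
    and a: "\<And>i j. i \<in> J \<Longrightarrow> j \<in> J \<Longrightarrow> a i j \<in> L"
    and stable: "\<And>i. i \<in> J \<Longrightarrow> u * w i = (\<Sum>j\<in>J. a i j * w j)"
  shows "algebraic_over L u"
proof -
  have "\<exists>c. (\<forall>j\<in>J. c j \<in> L) \<and> u ^ k = (\<Sum>j\<in>J. c j * w j)" for k
  proof (induction k)
    case 0
    have "(\<Sum>j\<in>J. (if j = j0 then 1 else 0) * w j) = (\<Sum>j\<in>J. if j = j0 then w j else 0)"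
      by (rule sum.cong) auto
    then have "(\<Sum>j\<in>J. (if j = j0 then 1 else 0) * w j) = 1"
      using J one by simp
    then show ?case
      using L by (intro exI[of _ "\<lambda>j. if j = j0 then 1 else 0"]) (auto intro: is_subfieldD)
  next
    case (Suc k)
    then obtain c where c: "\<forall>j\<in>J. c j \<in> L" "u ^ k = (\<Sum>j\<in>J. c j * w j)" by blast
    have "u ^ Suc k = (\<Sum>i\<in>J. c i * (u * w i))"
      by (simp add: c(2) sum_distrib_left mult_ac)
    also have "\<dots> = (\<Sum>i\<in>J. \<Sum>j\<in>J. c i * a i j * w j)"
      by (rule sum.cong) (simp_all add: stable sum_distrib_left mult_ac)
    also have "\<dots> = (\<Sum>j\<in>J. (\<Sum>i\<in>J. c i * a i j) * w j)"
      by (subst sum.swap) (simp add: sum_distrib_right)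
    finally show ?case
      using c(1) a L
      by (intro exI[of _ "\<lambda>j. \<Sum>i\<in>J. c i * a i j"]) (auto intro!: is_subfield_sum is_subfieldD)
  qed
  then obtain c where c: "\<And>k j. j \<in> J \<Longrightarrow> c k j \<in> L" "\<And>k. u ^ k = (\<Sum>j\<in>J. c k j * w j)"
    by metis
  \<comment> \<open>The powers \<open>u ^ 0, ..., u ^ card J\<close> are one more than the
    coordinates available to them, so they satisfy a nontrivial relation over
    \<open>L\<close>.\<close>
  obtain x where x: "\<forall>k\<in>{..card J}. x k \<in> L" "\<exists>k\<in>{..card J}. x k \<noteq> 0"
    "\<forall>j\<in>J. (\<Sum>k\<in>{..card J}. x k * c k j) = 0"
    using homogeneous_system_nontrivial_solution[OF L J, of "{..card J}" c] c(1) by auto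
  define p where "p = (\<Sum>k\<le>card J. monom (x k) k)"
  have cf: "coeff p k = (if k \<le> card J then x k else 0)" for k
    by (simp add: p_def coeff_sum sum.delta)
  have "poly p u = (\<Sum>k\<le>card J. x k * u ^ k)"
    by (simp add: p_def poly_sum poly_monom)
  also have "\<dots> = (\<Sum>k\<le>card J. \<Sum>j\<in>J. x k * c k j * w j)"
    by (simp add: c(2) sum_distrib_left mult_ac)
  also have "\<dots> = (\<Sum>j\<in>J. (\<Sum>k\<le>card J. x k * c k j) * w j)"
    by (subst sum.swap) (simp add: sum_distrib_right)
  also have "\<dots> = 0" using x(3) by simp
  finally have "poly p u = 0" .
  moreover have "p \<noteq> 0" using x(2) cf by (metis coeff_0 atMost_iff)
  moreover have "\<forall>k. coeff p k \<in> L" using x(1) L by (auto simp: cf intro: is_subfieldD)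
  ultimately show ?thesis unfolding algebraic_over_def by blast
qed

text \<open>Division by the leading coefficient. The relation makes the span of
  \<open>1, ..., x ^ (n - 1)\<close> stable under \<open>x\<close>, which is the form needed by
  \<open>algebraic_over_stable\<close>.\<close>

lemma algebraic_over_monic_relation:
  assumes L: "is_subfield L" and "algebraic_over L x"
  obtains n c where "n > 0" "\<And>i. i < n \<Longrightarrow> c i \<in> L" "x ^ n = (\<Sum>i<n. c i * x ^ i)"
proof -
  obtain p where p: "p \<noteq> 0" "\<forall>i. coeff p i \<in> L" "poly p x = 0"
    using assms(2) unfolding algebraic_over_def by blast
  let ?n = "degree p" and ?c = "\<lambda>i. - (coeff p i / lead_coeff p)"
  have n: "?n > 0"
    using p by (auto elim!: degree_eq_zeroE intro!: Nat.gr0I)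
  have "0 = (\<Sum>i\<le>?n. coeff p i * x ^ i) / lead_coeff p"
    using p(3) by (simp add: poly_altdef)
  also have "\<dots> = (\<Sum>i<?n. coeff p i / lead_coeff p * x ^ i) + x ^ ?n"
    using p(1) by (simp add: lessThan_Suc_atMost[symmetric] add_divide_distrib sum_divide_distrib)
  finally have "x ^ ?n = (\<Sum>i<?n. ?c i * x ^ i)"
    by (simp add: sum_negf eq_neg_iff_add_eq_0 add.commute)
  moreover have "?c i \<in> L" if "i < ?n" for i
    using p L by (auto intro!: is_subfieldD is_subfield_divide)
  ultimately show ?thesis using n by (intro that[of ?n ?c])
qed

text \<open>Both \<open>x\<close> and \<open>y\<close> act on the span of the \<open>x\<^sup>i y\<^sup>j\<close>.\<close>

lemma algebraic_over_add_mult: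
  fixes x y :: "'a::field"
  assumes L: "is_subfield L" and "algebraic_over L x" "algebraic_over L y"
  shows "algebraic_over L (x + y)" "algebraic_over L (x * y)"
proof -
  obtain n c where c: "n > 0" "\<And>i. i < n \<Longrightarrow> c i \<in> L" "x ^ n = (\<Sum>i<n. c i * x ^ i)"
    using algebraic_over_monic_relation assms by blast
  obtain m e where e: "m > 0" "\<And>i. i < m \<Longrightarrow> e i \<in> L" "y ^ m = (\<Sum>i<m. e i * y ^ i)"
    using algebraic_over_monic_relation assms by blast
  \<comment> \<open>The companion matrix: multiplication by \<open>z\<close> on the powers of
    \<open>z\<close> below \<open>n\<close>. The matrices \<open>a\<close> and \<open>b\<close>
    below are its Kronecker products with an identity matrix, one for \<open>x\<close> and one for
    \<open>y\<close>.\<close>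
  define S where "S c n i i' = (if Suc i = n then c i' else if i' = Suc i then 1 else 0 :: 'a)"
    for c n and i i' :: nat
  have S: "z * z ^ i = (\<Sum>i'<n. S c n i i' * z ^ i')" if "i < n" "z ^ n = (\<Sum>i<n. c i * z ^ i)"
    for z c n i
  proof (cases "Suc i = n")
    case True
    then show ?thesis using that(2) by (auto simp: S_def)
  next
    case False
    have "(\<Sum>i'<n. S c n i i' * z ^ i') = (\<Sum>i'<n. if i' = Suc i then z ^ i' else 0)"
      by (rule sum.cong) (use False in \<open>auto simp: S_def\<close>)
    then show ?thesis using that(1) False by simp
  qed
  have SL: "S c n i i' \<in> L" if "i' < n" "\<And>i. i < n \<Longrightarrow> c i \<in> L" for c n i i'
    using that L by (auto simp: S_def intro: is_subfieldD)
  let ?J = "{..<n} \<times> {..<m}"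
  define w where "w = (\<lambda>(i, j). x ^ i * y ^ j)"
  define a where "a = (\<lambda>(i, j :: nat) (i', j' :: nat). S c n i i' * (if j = j' then 1 else 0 :: 'a))"
  define b where "b = (\<lambda>(i :: nat, j) (i' :: nat, j'). (if i = i' then 1 else 0 :: 'a) * S e m j j')"
  have aL: "a p q \<in> L" and bL: "b p q \<in> L" if "p \<in> ?J" "q \<in> ?J" for p q
    using that SL c(2) e(2) L by (auto simp: a_def b_def intro!: is_subfieldD)
  have wx: "x * w p = (\<Sum>q\<in>?J. a p q * w q)" if pJ: "p \<in> ?J" for p
  proof -
    obtain i j where p: "p = (i, j)" "i < n" "j < m" using pJ by auto
    have "(\<Sum>q\<in>?J. a p q * w q) =
        (\<Sum>i'<n. \<Sum>j'<m. (S c n i i' * x ^ i') * (if j = j' then y ^ j' else 0))"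
      unfolding sum.cartesian_product p(1) by (rule sum.cong) (auto simp: a_def w_def)
    also have "\<dots> = (\<Sum>i'<n. S c n i i' * x ^ i') * y ^ j"
      using p by (simp add: sum_distrib_left[symmetric] sum_distrib_right)
    finally show ?thesis using S[OF p(2) c(3)] p by (simp add: w_def mult.assoc[symmetric])
  qed
  have wy: "y * w p = (\<Sum>q\<in>?J. b p q * w q)" if pJ: "p \<in> ?J" for p
  proof -
    obtain i j where p: "p = (i, j)" "i < n" "j < m" using pJ by auto
    have "(\<Sum>q\<in>?J. b p q * w q) =
        (\<Sum>i'<n. \<Sum>j'<m. (if i = i' then x ^ i' else 0) * (S e m j j' * y ^ j'))"
      unfolding sum.cartesian_product p(1) by (rule sum.cong) (auto simp: b_def w_def)
    also have "\<dots> = x ^ i * (\<Sum>j'<m. S e m j j' * y ^ j')"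
      using p by (simp add: sum_distrib_left[symmetric] sum_distrib_right[symmetric])
    finally show ?thesis using S[OF p(3) e(3)] p by (simp add: w_def mult_ac)
  qed
  have fin: "finite ?J" by simp
  have one: "(0, 0) \<in> ?J" "w (0, 0) = 1" using c e by (auto simp: w_def)
  show "algebraic_over L (x + y)"
  proof (rule algebraic_over_stable[where w = w and a = "\<lambda>p q. a p q + b p q", OF L fin one])
    show "a p q + b p q \<in> L" if "p \<in> ?J" "q \<in> ?J" for p q
      using aL bL that by (intro is_subfieldD[OF L])
    show "(x + y) * w p = (\<Sum>q\<in>?J. (a p q + b p q) * w q)" if "p \<in> ?J" for p
      using wx[OF that] wy[OF that] by (simp only: distrib_right sum.distrib)
  qed
  show "algebraic_over L (x * y)"
  proof (rule algebraic_over_stable[where w = w and a = "\<lambda>p q. \<Sum>r\<in>?J. b p r * a r q", OF L fin one])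
    show "(\<Sum>r\<in>?J. b p r * a r q) \<in> L" if "p \<in> ?J" "q \<in> ?J" for p q
      using aL bL that by (intro is_subfield_sum[OF L] is_subfieldD[OF L])
    fix p assume p: "p \<in> ?J"
    have "x * y * w p = x * (\<Sum>r\<in>?J. b p r * w r)"
      by (simp only: wy[OF p, symmetric] mult.assoc)
    also have "\<dots> = (\<Sum>r\<in>?J. b p r * (x * w r))"
      unfolding sum_distrib_left by (rule sum.cong) (simp_all only: mult_ac)
    also have "\<dots> = (\<Sum>r\<in>?J. \<Sum>q\<in>?J. b p r * a r q * w q)"
      by (rule sum.cong[OF refl]) (simp only: wx sum_distrib_left mult.assoc)
    also have "\<dots> = (\<Sum>q\<in>?J. (\<Sum>r\<in>?J. b p r * a r q) * w q)"
      unfolding sum_distrib_right by (rule sum.swap)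
    finally show "x * y * w p = (\<Sum>q\<in>?J. (\<Sum>r\<in>?J. b p r * a r q) * w q)" .
  qed
qed

lemma algebraic_over_self:
  assumes "is_subfield L" "x \<in> L"
  shows "algebraic_over L x"
  unfolding algebraic_over_def
  using assms
  by (intro exI[of _ "[:- x, 1:]"])
     (auto simp: coeff_pCons split: nat.splits intro: is_subfieldD)

lemma algebraic_over_inverse:
  assumes L: "is_subfield L" and "algebraic_over L x"
  shows "algebraic_over L (inverse x)"
proof (cases "x = 0")
  case True
  then show ?thesis using algebraic_over_self[OF L] is_subfieldD(1)[OF L] by simp
next
  case False
  obtain p where p: "p \<noteq> 0" "\<forall>i. coeff p i \<in> L" "poly p x = 0"
    using assms(2) unfolding algebraic_over_def by blast
  \<comment> \<open>Reversing the coefficients turns a root \<open>x\<close> into the root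
    \<open>inverse x\<close>.\<close>
  have "poly (reflect_poly p) (inverse x) = 0"
    using p(3) False by (simp add: poly_reflect_poly_nz)
  then show ?thesis
    using p is_subfieldD(1)[OF L] unfolding algebraic_over_def
    by (intro exI[of _ "reflect_poly p"]) (auto simp: coeff_reflect_poly)
qed

lemma is_subfield_algebraic:
  assumes L: "is_subfield L"
  shows "is_subfield {x. algebraic_over L x}"
proof -
  have "algebraic_over L (- x)" if "algebraic_over L x" for x
    using algebraic_over_add_mult(2)[OF L algebraic_over_self[OF L, of "-1"] that] L
    by (auto intro: is_subfieldD)
  then show ?thesis
    using algebraic_over_self[OF L] algebraic_over_add_mult[OF L] algebraic_over_inverse[OF L]
      is_subfieldD[OF L]
    by (auto simp: is_subfield_def is_subring_def)
qed

section \<open>Polynomials\<close>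

text \<open>Keys shrink and grow under arithmetic; a common finite index set lets values of
  different exponent vectors be compared factor by factor.\<close>

lemma monom_val_superset:
  assumes "finite V" "Poly_Mapping.keys e \<subseteq> V"
  shows "monom_val \<rho> e = (\<Prod>v\<in>V. \<rho> v ^ Poly_Mapping.lookup e v)"
  unfolding monom_val_def
  by (rule prod.mono_neutral_left) (use assms in \<open>auto simp: in_keys_iff\<close>)

lemma monom_val_0 [simp]: "monom_val \<rho> 0 = 1"
  by (simp add: monom_val_def)

lemma monom_val_single [simp]: "monom_val \<rho> (Poly_Mapping.single v k) = \<rho> v ^ k"
  by (subst monom_val_superset[of "{v}"]) simp_all

lemma monom_val_add: "monom_val \<rho> (e + e') = monom_val \<rho> e * monom_val \<rho> e'"
proof -
  let ?V = "Poly_Mapping.keys e \<union> Poly_Mapping.keys e'"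
  show ?thesis
    by (subst (1 2 3) monom_val_superset[of ?V])
       (use keys_add[of e e'] in \<open>auto simp: lookup_add power_add prod.distrib\<close>)
qed

lemma mpol_eval_superset:
  assumes "\<phi> 0 = 0" "finite A" "Poly_Mapping.keys p \<subseteq> A"
  shows "mpol_eval \<phi> \<rho> p = (\<Sum>e\<in>A. \<phi> (Poly_Mapping.lookup p e) * monom_val \<rho> e)"
  unfolding mpol_eval_def
  by (rule sum.mono_neutral_left) (use assms in \<open>auto simp: in_keys_iff\<close>)

lemma mpol_eval_single:
  "\<phi> 0 = 0 \<Longrightarrow> mpol_eval \<phi> \<rho> (Poly_Mapping.single e c) = \<phi> c * monom_val \<rho> e"
  by (subst mpol_eval_superset[of _ "{e}"]) simp_all

lemma mpol_eval_0 [simp]: "mpol_eval \<phi> \<rho> 0 = 0"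
  by (simp add: mpol_eval_def)

lemma mpol_eval_mconst: "\<phi> 0 = 0 \<Longrightarrow> mpol_eval \<phi> \<rho> (mconst c) = \<phi> c"
  by (simp add: mconst_def mpol_eval_single)

lemma mpol_eval_mvar: "\<phi> 0 = 0 \<Longrightarrow> \<phi> 1 = 1 \<Longrightarrow> mpol_eval \<phi> \<rho> (mvar v) = \<rho> v"
  by (simp add: mvar_def mpol_eval_single)

context comm_ring_hom
begin

lemma mpol_eval_add: "mpol_eval hom \<rho> (p + q) = mpol_eval hom \<rho> p + mpol_eval hom \<rho> q"
proof -
  let ?A = "Poly_Mapping.keys p \<union> Poly_Mapping.keys q"
  show ?thesis
    by (subst (1 2 3) mpol_eval_superset[of _ ?A])
       (use keys_add[of p q] in \<open>auto simp: lookup_add hom_add sum.distrib distrib_right\<close>)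
qed

lemma mpol_eval_sum: "mpol_eval hom \<rho> (sum p A) = (\<Sum>x\<in>A. mpol_eval hom \<rho> (p x))"
  by (induction A rule: infinite_finite_induct) (simp_all add: mpol_eval_add)

lemma mpol_eval_mult: "mpol_eval hom \<rho> (p * q) = mpol_eval hom \<rho> p * mpol_eval hom \<rho> q"
proof -
  let ?s = "\<lambda>p e. Poly_Mapping.single e (Poly_Mapping.lookup p e)"
  let ?P = "Poly_Mapping.keys p" and ?Q = "Poly_Mapping.keys q"
  have *: "mpol_eval hom \<rho> (?s p e * ?s q e') = mpol_eval hom \<rho> (?s p e) * mpol_eval hom \<rho> (?s q e')"
    for e e' by (simp add: mult_single mpol_eval_single monom_val_add hom_mult mult_ac)
  have "p * q = (\<Sum>e\<in>?P. \<Sum>e'\<in>?Q. ?s p e * ?s q e')"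
    by (simp only: sum_product[symmetric] mpol_sum_single)
  then have "mpol_eval hom \<rho> (p * q) =
      mpol_eval hom \<rho> (\<Sum>e\<in>?P. ?s p e) * mpol_eval hom \<rho> (\<Sum>e'\<in>?Q. ?s q e')"
    by (simp only: mpol_eval_sum * sum_product)
  then show ?thesis by (simp only: mpol_sum_single)
qed

lemma mpol_eval_1 [simp]: "mpol_eval hom \<rho> 1 = 1"
  using mpol_eval_single[of hom \<rho> 0 1] by simp

lemma comm_ring_hom_mpol_eval: "comm_ring_hom (mpol_eval hom \<rho>)"
  by unfold_locales (simp_all add: mpol_eval_add mpol_eval_mult)

end

lemma comm_ring_hom_mconst: "comm_ring_hom mconst"
  by unfold_locales (simp_all add: mconst_def single_add mult_single)

lemma mconst_eq_iff [simp]: "mconst a = mconst b \<longleftrightarrow> a = b"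
  by (metis mconst_def lookup_single_eq)

text \<open>Constants and variables generate the polynomial ring. With this rule, identities between
  homomorphisms or derivations need checking on generators only.\<close>

lemma mpol_induct [case_names const var add mult]:
  fixes p :: "('v, 'a::comm_ring_1) mpol"
  assumes const: "\<And>c. P (mconst c)" and var: "\<And>v. P (mvar v)"
    and add: "\<And>p q. P p \<Longrightarrow> P q \<Longrightarrow> P (p + q)"
    and mult: "\<And>p q. P p \<Longrightarrow> P q \<Longrightarrow> P (p * q)"
  shows "P p"
proof -
  have 0: "P 0" and 1: "P 1"
    using const[of 0] const[of 1] by (simp_all add: mconst_def)
  have single: "P (Poly_Mapping.single (Poly_Mapping.single v k) 1)" for v k
  proof (induction k)
    case 0
    show ?case using 1 by simp
  next
    case (Suc k)
    have "Poly_Mapping.single (Poly_Mapping.single v (Suc k)) (1::'a) =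
        Poly_Mapping.single (Poly_Mapping.single v k) 1 * mvar v"
      by (simp add: mvar_def mult_single single_add[symmetric])
    then show ?case using Suc var mult by simp
  qed
  have "P (Poly_Mapping.single (\<Sum>v\<in>V. Poly_Mapping.single v (Poly_Mapping.lookup e v)) 1)" for e V
  proof (induction V rule: infinite_finite_induct)
    case (insert v V)
    then show ?case using mult[OF single insert.IH] by (simp add: mult_single)
  qed (use 1 in simp_all)
  \<comment> \<open>An exponent vector is itself a finitely supported map, so
    \<open>mpol_sum_single\<close> applies to \<open>e\<close> and splits it into pure
    powers.\<close>
  then have "P (Poly_Mapping.single e 1)" for e
    using mpol_sum_single[of e] by metis
  then have "P (mconst c * Poly_Mapping.single e 1)" for e c
    using const mult by blast
  then have *: "P (Poly_Mapping.single e c)" for e c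
    by (simp add: mconst_def mult_single)
  have "P (\<Sum>e\<in>A. Poly_Mapping.single e (Poly_Mapping.lookup p e))" for A
    by (induction A rule: infinite_finite_induct) (simp_all add: 0 * add)
  then show ?thesis using mpol_sum_single[of p] by metis
qed

lemma comm_ring_hom_mpol_eqI:
  assumes "comm_ring_hom h" "comm_ring_hom h'"
    and "\<And>c. h (mconst c) = h' (mconst c)" "\<And>v. h (mvar v) = h' (mvar v)"
  shows "h p = h' p"
proof -
  interpret h: comm_ring_hom h by fact
  interpret h': comm_ring_hom h' by fact
  show ?thesis
    by (induction p rule: mpol_induct) (simp_all add: assms h.hom_add h'.hom_add h.hom_mult h'.hom_mult)
qed

text \<open>Both sides are additive in \<open>p\<close> and obey the same product rule along
  \<open>h\<close>, so agreement on constants and variables suffices.\<close>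

lemma comm_ring_hom_mpol_deriv:
  assumes "comm_ring_hom h" and d: "derivation d" and D: "derivation D"
    and "\<And>c. h (mconst (d c)) = D (h (mconst c))" "\<And>v. h (g v) = D (h (mvar v))"
  shows "h (mpol_deriv d g p) = D (h p)"
proof -
  interpret h: comm_ring_hom h by fact
  show ?thesis
    using derivation_mpol_deriv[OF d, of g] D assms(4,5)
    by (induction p rule: mpol_induct)
       (auto simp: mpol_deriv_mconst[OF d] mpol_deriv_mvar[OF d] derivation_def h.hom_add h.hom_mult)
qed

section \<open>Rational functions\<close>

lemma comm_ring_hom_to_fract: "comm_ring_hom to_fract"
  by unfold_locales simp_all

lemma comm_ring_hom_rconst: "comm_ring_hom (rconst :: 'a::field \<Rightarrow> ('n::finite, 'a) ratfun)"
proof -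
  interpret mc: comm_ring_hom "mconst :: 'a \<Rightarrow> ('n xvar, 'a) mpol" by (rule comm_ring_hom_mconst)
  show ?thesis
    by unfold_locales (simp_all add: rconst_def mc.hom_add mc.hom_mult)
qed

global_interpretation rconst: comm_ring_hom "rconst :: 'a::field \<Rightarrow> ('n::finite, 'a) ratfun"
  by (rule comm_ring_hom_rconst)

lemma rconst_eq_iff [simp]: "rconst a = rconst b \<longleftrightarrow> a = b"
  by (simp add: rconst_def)

lemma rconst_eq_0_iff [simp]: "rconst a = 0 \<longleftrightarrow> a = 0"
  by (metis rconst.hom_zero rconst_eq_iff)

lemma rconst_inverse: "rconst (inverse a) = inverse (rconst a)"
proof (cases "a = 0")
  case False
  then have "rconst (inverse a) * rconst a = 1"
    by (simp flip: rconst.hom_mult)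
  then show ?thesis by (metis inverse_unique mult.commute)
qed simp

lemma rconst_image_subfield: "is_subfield K \<Longrightarrow> is_subfield (rconst ` K)"
  unfolding is_subfield_def is_subring_def
  by (auto simp flip: rconst_inverse rconst.hom_add rconst.hom_mult rconst.hom_uminus)
     (use rconst.hom_zero rconst.hom_one in \<open>metis image_eqI\<close>)+

lemma to_fract_eq_mpol_eval:
  "to_fract p = mpol_eval rconst (\<lambda>x. case x of XVar i j \<Rightarrow> rX i j) p"
  by (rule comm_ring_hom_mpol_eqI[OF comm_ring_hom_to_fract rconst.comm_ring_hom_mpol_eval])
     (simp_all add: mpol_eval_mconst mpol_eval_mvar rconst_def[symmetric] rX_def split: xvar.split)

lemma ratfun_cases:
  obtains a b where "b \<noteq> 0" "x = to_fract a / to_fract b"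
  by (cases x) (auto simp: Fract_conv_to_fract)

text \<open>The generation principle for \<open>F(X_ij)\<close>: a property holds everywhere once
  the elements having it form a subfield containing \<open>F\<close> and the
  \<open>X_ij\<close>.\<close>

lemma subfield_ratfun_UNIV:
  fixes S :: "('n::finite, 'a::field) ratfun set"
  assumes S: "is_subfield S" and "range rconst \<subseteq> S" "\<And>i j. rX i j \<in> S"
  shows "S = UNIV"
proof -
  have "to_fract p \<in> S" for p :: "('n xvar, 'a) mpol"
  proof (induction p rule: mpol_induct)
    case (const c)
    then show ?case using assms(2) by (auto simp: rconst_def)
  next
    case (var v)
    then show ?case using assms(3) by (cases v) (simp add: rX_def)
  qed (use is_subfieldD[OF S] in auto)
  then have "x \<in> S" for x :: "('n, 'a) ratfun"
    using is_subfield_divide[OF S] by (cases x rule: ratfun_cases) auto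
  then show ?thesis by auto
qed

lemma field_hom_divide:
  fixes h :: "'a::field \<Rightarrow> 'b::field"
  assumes "comm_ring_hom h"
  shows "h (x / y) = h x / h y"
proof -
  interpret comm_ring_hom h by fact
  show ?thesis
  proof (cases "y = 0")
    case False
    have "h (x / y) * h y = h x" "h (inverse y) * h y = 1"
      using False by (simp_all flip: hom_mult)
    then show ?thesis by (metis mult_zero_right zero_neq_one nonzero_eq_divide_eq)
  qed simp
qed

lemma ratfun_hom_eqI:
  fixes h h' :: "('n::finite, 'a::field) ratfun \<Rightarrow> 'b::field"
  assumes h: "comm_ring_hom h" and h': "comm_ring_hom h'"
    and "\<And>c. h (rconst c) = h' (rconst c)" "\<And>i j. h (rX i j) = h' (rX i j)"
  shows "h = h'"
proof
  fix x :: "('n, 'a) ratfun"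
  interpret h: comm_ring_hom h by fact
  interpret h': comm_ring_hom h' by fact
  have "is_subfield {x. h x = h' x}"
    using field_hom_divide[OF h, of 1] field_hom_divide[OF h', of 1]
    by (auto simp: is_subfield_def is_subring_def h.hom_add h'.hom_add h.hom_mult h'.hom_mult
        h.hom_uminus h'.hom_uminus inverse_eq_divide)
  from subfield_ratfun_UNIV[OF this] show "h x = h' x" using assms by auto
qed

text \<open>Injectivity keeps the images of denominators nonzero; cross-multiplication then shows
  that \<open>h a / h b\<close> depends only on the fraction.\<close>

lemma fract_hom_extension:
  fixes h :: "'a::idom \<Rightarrow> 'b::field"
  assumes "comm_ring_hom h" and inj: "\<And>a. h a = 0 \<Longrightarrow> a = 0"
  obtains H where "comm_ring_hom H" "\<And>a. H (to_fract a) = h a"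
proof -
  interpret comm_ring_hom h by fact
  define H where "H x = (THE y. \<exists>a b. b \<noteq> 0 \<and> x = Fract a b \<and> y = h a / h b)" for x
  have nz: "h a \<noteq> 0" if "a \<noteq> 0" for a using inj that by blast
  have H: "H (Fract a b) = h a / h b" if "b \<noteq> 0" for a b
    unfolding H_def
  proof (rule the_equality)
    fix y assume "\<exists>a' b'. b' \<noteq> 0 \<and> Fract a b = Fract a' b' \<and> y = h a' / h b'"
    then obtain a' b' where "b' \<noteq> 0" "a * b' = a' * b" "y = h a' / h b'"
      using \<open>b \<noteq> 0\<close> by (auto simp: eq_fract)
    then show "y = h a / h b"
      using nz \<open>b \<noteq> 0\<close> by (simp add: frac_eq_eq flip: hom_mult)
  qed (use that in blast)
  have "comm_ring_hom H"
  proof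
    fix x y :: "'a fract"
    obtain a b where x: "x = Fract a b" "b \<noteq> 0" by (cases x) auto
    obtain a' b' where y: "y = Fract a' b'" "b' \<noteq> 0" by (cases y) auto
    show "H (x + y) = H x + H y" "H (x * y) = H x * H y"
      using x y nz by (simp_all add: H hom_add hom_mult field_simps)
  qed (simp_all add: Zero_fract_def One_fract_def H)
  moreover have "H (to_fract a) = h a" for a by (simp add: to_fract_def H)
  ultimately show ?thesis using that by blast
qed

section \<open>Wronskians and linear differential equations\<close>

lemma derivation_funpow_sum_constants:
  assumes D: "derivation D" and c: "\<And>i. i \<in> A \<Longrightarrow> c i \<in> constants D"
  shows "(D ^^ r) (\<Sum>i\<in>A. c i * y i) = (\<Sum>i\<in>A. c i * (D ^^ r) (y i))"
proof (induction r)
  case (Suc r)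
  have "D (c i * x) = c i * D x" if "i \<in> A" for i x
    using D c[OF that] by (simp add: derivation_def constants_def)
  then show ?case
    by (simp add: Suc derivation_sum[OF D])
qed simp

text \<open>The hard half of the wronskian criterion: a null vector with arbitrary entries is traded
  for one with constant entries. If the first \<open>N\<close> functions already admit a null
  vector, induction applies. Otherwise the given one can be scaled to have last entry 1, and
  differentiating its relations shows that the other entries are constant.\<close>

lemma constants_dependence_of_null_vector:
  fixes D :: "'a::field \<Rightarrow> 'a"
  assumes D: "derivation D"
    and "\<exists>s<N. v s \<noteq> 0" "\<And>r. r < N \<Longrightarrow> (\<Sum>s<N. v s * (D ^^ r) (y s)) = 0"
  shows "\<exists>c. (\<forall>s<N. c s \<in> constants D) \<and> (\<exists>s<N. c s \<noteq> 0) \<and> (\<Sum>s<N. c s * y s) = 0"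
  using assms(2,3)
proof (induction N arbitrary: v)
  case (Suc N)
  show ?case
  proof (cases "\<exists>w. (\<exists>s<N. w s \<noteq> 0) \<and> (\<forall>r<N. (\<Sum>s<N. w s * (D ^^ r) (y s)) = 0)")
    case True
    then obtain c where c: "\<forall>s<N. c s \<in> constants D" "\<exists>s<N. c s \<noteq> 0" "(\<Sum>s<N. c s * y s) = 0"
      using Suc.IH by blast
    then show ?thesis
      using derivation_zero[OF D]
      \<comment> \<open>The last function takes no part in the relation.\<close>
      by (intro exI[of _ "c(N := 0)"]) (auto simp: less_Suc_eq constants_def)
  next
    case False
    then have indep: "w s = 0"
      if "\<And>r. r < N \<Longrightarrow> (\<Sum>s<N. w s * (D ^^ r) (y s)) = 0" "s < N" for w s
      using that by blast
    have "v N \<noteq> 0"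
    proof
      assume vN: "v N = 0"
      have "(\<Sum>s<N. v s * (D ^^ r) (y s)) = 0" if "r < N" for r
        using Suc.prems(2)[of r] that vN by simp
      then have "\<forall>s<N. v s = 0" using indep by blast
      then show False using Suc.prems(1) vN by (auto simp: less_Suc_eq)
    qed
    define u where "u s = v s / v N" for s
    have u: "(\<Sum>s<N. u s * (D ^^ r) (y s)) + (D ^^ r) (y N) = 0" if "r < Suc N" for r
    proof -
      have "(\<Sum>s<Suc N. u s * (D ^^ r) (y s)) = (\<Sum>s<Suc N. v s * (D ^^ r) (y s)) / v N"
        by (simp add: u_def sum_divide_distrib add_divide_distrib)
      then show ?thesis using Suc.prems(2)[OF that] \<open>v N \<noteq> 0\<close> by (simp add: u_def)
    qed
    \<comment> \<open>Differentiating relation \<open>r\<close> and subtracting relation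
      \<open>r + 1\<close> leaves only the terms with \<open>D (u s)\<close>. The extra row
      \<open>N\<close> of the system supplies relation \<open>r + 1\<close> for every
      \<open>r < N\<close>.\<close>
    have "(\<Sum>s<N. D (u s) * (D ^^ r) (y s)) = 0" if r: "r < N" for r
    proof -
      have "0 = D ((\<Sum>s<N. u s * (D ^^ r) (y s)) + (D ^^ r) (y N))"
        using u[of r] r derivation_zero[OF D] by simp
      also have "\<dots> = D (\<Sum>s<N. u s * (D ^^ r) (y s)) + (D ^^ Suc r) (y N)"
        using D by (simp add: derivation_def)
      also have "D (\<Sum>s<N. u s * (D ^^ r) (y s)) =
          (\<Sum>s<N. D (u s) * (D ^^ r) (y s) + u s * (D ^^ Suc r) (y s))"
        using D by (simp add: derivation_sum[OF D] derivation_def)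
      finally show ?thesis using u[of "Suc r"] r by (simp add: sum.distrib add.assoc)
    qed
    then have "\<forall>s<N. D (u s) = 0" using indep[of "\<lambda>s. D (u s)"] by blast
    moreover have "u N = 1" using \<open>v N \<noteq> 0\<close> by (simp add: u_def)
    ultimately show ?thesis
      using u[of 0] derivation_one[OF D]
      by (intro exI[of _ u]) (auto simp: less_Suc_eq constants_def)
  qed
qed simp

lemma wronskian_eq_0_iff:
  fixes D :: "'a::field \<Rightarrow> 'a"
  assumes D: "derivation D"
  shows "wronskian D ys = 0 \<longleftrightarrow> (\<exists>c. (\<forall>s<length ys. c s \<in> constants D) \<and>
    (\<exists>s<length ys. c s \<noteq> 0) \<and> (\<Sum>s<length ys. c s * ys ! s) = 0)" (is "_ \<longleftrightarrow> ?R")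
proof -
  let ?N = "length ys"
  let ?A = "Matrix.mat ?N ?N (\<lambda>(r, s). (D ^^ r) (ys ! s))"
  have A: "?A \<in> carrier_mat ?N ?N" by simp
  have mv: "(?A *\<^sub>v Matrix.vec ?N v = 0\<^sub>v ?N) \<longleftrightarrow> (\<forall>r<?N. (\<Sum>s<?N. v s * (D ^^ r) (ys ! s)) = 0)" for v
    by (auto simp: vec_eq_iff scalar_prod_def atLeast0LessThan mult.commute)
  have "wronskian D ys = 0 \<longleftrightarrow>
      (\<exists>v. (\<exists>s<?N. v s \<noteq> 0) \<and> (\<forall>r<?N. (\<Sum>s<?N. v s * (D ^^ r) (ys ! s)) = 0))"
    unfolding wronskian_def det_0_iff_vec_prod_zero_field[OF A]
  proof safe
    fix v assume v: "v \<in> carrier_vec ?N" "v \<noteq> 0\<^sub>v ?N" "?A *\<^sub>v v = 0\<^sub>v ?N"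
    then have "v = Matrix.vec ?N (\<lambda>s. vec_index v s)" by auto
    then show "\<exists>v. (\<exists>s<?N. v s \<noteq> 0) \<and> (\<forall>r<?N. (\<Sum>s<?N. v s * (D ^^ r) (ys ! s)) = 0)"
      using v mv[of "\<lambda>s. vec_index v s"] by (intro exI[of _ "\<lambda>s. vec_index v s"]) auto
  next
    fix v s assume "s < ?N" "v s \<noteq> (0::'a)" "\<forall>r<?N. (\<Sum>s<?N. v s * (D ^^ r) (ys ! s)) = 0"
    then show "\<exists>v. v \<in> carrier_vec ?N \<and> v \<noteq> 0\<^sub>v ?N \<and> ?A *\<^sub>v v = 0\<^sub>v ?N"
      using mv[of v] by (intro exI[of _ "Matrix.vec ?N v"]) (auto simp: vec_eq_iff)
  qed
  also have "\<dots> \<longleftrightarrow> ?R"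
  proof
    assume ?R
    then obtain c where c: "\<forall>s<?N. c s \<in> constants D" "\<exists>s<?N. c s \<noteq> 0" "(\<Sum>s<?N. c s * ys ! s) = 0"
      by blast
    have "(D ^^ r) 0 = 0" for r
      by (induction r) (simp_all add: derivation_zero[OF D])
    then have "(\<Sum>s<?N. c s * (D ^^ r) (ys ! s)) = 0" for r
      using derivation_funpow_sum_constants[OF D, of "{..<?N}" c r "\<lambda>s. ys ! s"] c by simp
    then show "\<exists>v. (\<exists>s<?N. v s \<noteq> 0) \<and> (\<forall>r<?N. (\<Sum>s<?N. v s * (D ^^ r) (ys ! s)) = 0)"
      using c by blast
  qed (use constants_dependence_of_null_vector[OF D, of ?N _ "\<lambda>s. ys ! s"] in blast)
  finally show ?thesis .
qed

text \<open>Coefficients are indexed by the entries instead of their positions, so that the order of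
  enumeration disappears from the criterion; distinctness makes the positions recoverable.\<close>

lemma wronskian_map_eq_0_iff:
  fixes D :: "'a::field \<Rightarrow> 'a"
  assumes D: "derivation D" and "distinct es"
  shows "wronskian D (map v es) = 0 \<longleftrightarrow> (\<exists>c. (\<forall>e\<in>set es. c e \<in> constants D) \<and>
    (\<exists>e\<in>set es. c e \<noteq> 0) \<and> (\<Sum>e\<in>set es. c e * v e) = 0)" (is "_ \<longleftrightarrow> ?R")
proof -
  let ?N = "length es"
  have bij: "bij_betw ((!) es) {..<?N} (set es)"
    using bij_betw_nth[OF \<open>distinct es\<close> refl refl] .
  have sum: "(\<Sum>e\<in>set es. g e) = (\<Sum>s<?N. g (es ! s))" for g :: "_ \<Rightarrow> 'a"
    by (rule sum.reindex_bij_betw[OF bij, symmetric])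
  show ?thesis
  proof
    assume "wronskian D (map v es) = 0"
    then obtain c where c: "\<forall>s<?N. c s \<in> constants D" "\<exists>s<?N. c s \<noteq> 0" "(\<Sum>s<?N. c s * v (es ! s)) = 0"
      unfolding wronskian_eq_0_iff[OF D] by auto
    define c' where "c' e = c (inv_into {..<?N} ((!) es) e)" for e
    have "c' (es ! s) = c s" if "s < ?N" for s
      using that bij by (simp add: c'_def bij_betw_def)
    moreover from this obtain s where "s < ?N" "c' (es ! s) \<noteq> 0" using c(2) by auto
    then have "\<exists>e\<in>set es. c' e \<noteq> 0" using nth_mem by blast
    ultimately show ?R
      using c unfolding sum by (intro exI[of _ c']) (auto simp: in_set_conv_nth intro: nth_mem)
  next
    assume ?R
    then obtain c where c: "\<forall>e\<in>set es. c e \<in> constants D" "\<exists>e\<in>set es. c e \<noteq> 0" "(\<Sum>e\<in>set es. c e * v e) = 0"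
      by blast
    from c(2) obtain s where "s < ?N" "c (es ! s) \<noteq> 0" by (auto simp: in_set_conv_nth)
    then show "wronskian D (map v es) = 0"
      using c(1,3) unfolding wronskian_eq_0_iff[OF D] sum
      by (intro exI[of _ "\<lambda>s. c (es ! s)"]) auto
  qed
qed

text \<open>The criterion needs a field, whereas \<open>W_k\<close> lives in a polynomial ring. A
  differential homomorphism commutes with all entries and with the determinant, so the specialized
  \<open>W_k\<close> is again a wronskian.\<close>

lemma wronskian_hom:
  assumes "comm_ring_hom h" "\<And>x. h (D x) = D' (h x)"
  shows "h (wronskian D ys) = wronskian D' (map h ys)"
proof -
  interpret comm_ring_hom h by fact
  have "h ((D ^^ r) x) = (D' ^^ r) (h x)" for r x
    by (induction r) (simp_all add: assms(2))
  then have "map_mat h (Matrix.mat (length ys) (length ys) (\<lambda>(r, s). (D ^^ r) (ys ! s))) =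
      Matrix.mat (length ys) (length ys) (\<lambda>(r, s). (D' ^^ r) (map h ys ! s))"
    by (intro eq_matI) auto
  then show ?thesis unfolding wronskian_def by (simp flip: hom_det)
qed

text \<open>The equation is a linear relation among rows \<open>0, ..., N\<close> of the wronskian
  matrix; row \<open>N\<close> exists because there are more than \<open>N\<close>
  functions.\<close>

lemma wronskian_lin_ode_solutions:
  fixes D :: "'a::field \<Rightarrow> 'a"
  assumes ys: "set ys \<subseteq> lin_ode_solutions D N a" and N: "N < length ys"
  shows "wronskian D ys = 0"
proof -
  let ?M = "length ys"
  let ?A = "Matrix.mat ?M ?M (\<lambda>(r, s). (D ^^ r) (ys ! s))"
  \<comment> \<open>Coefficients of the monic equation, padded with zeros. The entry 1 at index
    \<open>N\<close> makes this vector nonzero.\<close>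
  define c where "c r = (if r < N then a r else if r = N then 1 else 0)" for r
  have "transpose_mat ?A *\<^sub>v Matrix.vec ?M c = 0\<^sub>v ?M"
  proof (rule eq_vecI)
    fix s assume "s < dim_vec (0\<^sub>v ?M :: 'a vec)"
    then have s: "s < ?M" by simp
    have "(\<Sum>r<?M. (D ^^ r) (ys ! s) * c r) = (\<Sum>r<Suc N. (D ^^ r) (ys ! s) * c r)"
      by (rule sum.mono_neutral_right) (use N in \<open>auto simp: c_def\<close>)
    also have "\<dots> = 0"
    proof -
      have "ys ! s \<in> lin_ode_solutions D N a" using s ys by auto
      then show ?thesis by (simp add: c_def lin_ode_solutions_def mult.commute add.commute)
    qed
    finally show "vec_index (transpose_mat ?A *\<^sub>v Matrix.vec ?M c) s = vec_index (0\<^sub>v ?M) s"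
      using s by (simp add: scalar_prod_def atLeast0LessThan)
  qed simp
  moreover have "Matrix.vec ?M c \<noteq> 0\<^sub>v ?M"
  proof
    assume *: "Matrix.vec ?M c = 0\<^sub>v ?M"
    have "vec_index (Matrix.vec ?M c) N = 0" unfolding * using N by simp
    then show False using N by (simp add: c_def)
  qed
  moreover have "transpose_mat ?A \<in> carrier_mat ?M ?M" by simp
  ultimately have "Determinant.det (transpose_mat ?A) = 0"
    using det_0_iff_vec_prod_zero_field[of "transpose_mat ?A" ?M] by (meson vec_carrier)
  then show ?thesis
    unfolding wronskian_def by (subst Determinant.det_transpose[symmetric, of _ ?M]) auto
qed

text \<open>Any further solution \<open>v\<close> joins the \<open>b i\<close> to give
  \<open>N + 1\<close> solutions of an equation of order \<open>N\<close>, hence a dependence over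
  the constants. Independence of the \<open>b i\<close> makes the coefficient of \<open>v\<close>
  nonzero.\<close>

lemma has_dim_lin_ode_solutions:
  fixes D :: "'a::field \<Rightarrow> 'a"
  assumes D: "derivation D"
    and b: "\<And>i. i < N \<Longrightarrow> b i \<in> lin_ode_solutions D N a"
    and indep: "\<And>c. (\<And>i. i < N \<Longrightarrow> c i \<in> constants D) \<Longrightarrow> (\<Sum>i<N. c i * b i) = 0 \<Longrightarrow> \<forall>i<N. c i = 0"
  shows "has_dim (constants D) (lin_ode_solutions D N a) N"
proof -
  have "\<exists>c. (\<forall>i<N. c i \<in> constants D) \<and> v = (\<Sum>i<N. c i * b i)"
    if v: "v \<in> lin_ode_solutions D N a" for v
  proof -
    let ?ys = "map b [0..<N] @ [v]"
    have "wronskian D ?ys = 0"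
      by (rule wronskian_lin_ode_solutions[of _ _ N a]) (use b v in auto)
    then obtain c where c: "\<forall>s<Suc N. c s \<in> constants D" "\<exists>s<Suc N. c s \<noteq> 0"
      "(\<Sum>s<Suc N. c s * ?ys ! s) = 0"
      unfolding wronskian_eq_0_iff[OF D] by auto
    have eq: "(\<Sum>s<N. c s * b s) + c N * v = 0"
      using c(3) by (simp add: nth_append)
    have "c N \<noteq> 0"
    proof
      assume "c N = 0"
      have "\<forall>i<N. c i = 0" by (rule indep) (use c(1) eq \<open>c N = 0\<close> in auto)
      then show False using c(2) \<open>c N = 0\<close> by (auto simp: less_Suc_eq)
    qed
    have "v * c N = - (\<Sum>i<N. c i * b i)"
      using eq by (simp add: eq_neg_iff_add_eq_0 mult.commute add.commute)
    then have "v = - (\<Sum>i<N. c i * b i) / c N"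
      using nonzero_eq_divide_eq[OF \<open>c N \<noteq> 0\<close>] by blast
    also have "\<dots> = (\<Sum>i<N. - (c i / c N) * b i)"
      by (simp add: sum_divide_distrib sum_negf)
    finally have "v = (\<Sum>i<N. - (c i / c N) * b i)" .
    moreover have "- (c i / c N) \<in> constants D" if "i < N" for i
      using c(1) that is_subfield_constants[OF D]
      by (auto intro!: is_subfieldD is_subfield_divide)
    ultimately show ?thesis by (intro exI[of _ "\<lambda>i. - (c i / c N)"] conjI allI impI)
  qed
  moreover have "\<forall>c. (\<forall>i<N. c i \<in> constants D) \<and> (\<Sum>i<N. c i * b i) = 0 \<longrightarrow> (\<forall>i<N. c i = 0)"
    using indep by auto
  ultimately show ?thesis
    unfolding has_dim_def using b by (intro exI[of _ b]) simp
qed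

section \<open>Specialization of the wronskians\<close>

text \<open>\<open>enum_by\<close> is a definite description, so unique existence is required.
  Counting the elements below a given one embeds \<open>S\<close> into the natural numbers in an
  order-preserving way and reduces this to sorted lists of naturals.\<close>

lemma enum_by_correct:
  assumes S: "finite S" and refl: "\<And>a. a \<in> S \<Longrightarrow> mle a a"
    and antisym: "\<And>a b. a \<in> S \<Longrightarrow> b \<in> S \<Longrightarrow> mle a b \<Longrightarrow> mle b a \<Longrightarrow> a = b"
    and trans: "\<And>a b c. a \<in> S \<Longrightarrow> b \<in> S \<Longrightarrow> c \<in> S \<Longrightarrow> mle a b \<Longrightarrow> mle b c \<Longrightarrow> mle a c"
    and total: "\<And>a b. a \<in> S \<Longrightarrow> b \<in> S \<Longrightarrow> mle a b \<or> mle b a"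
  shows "set (enum_by mle S) = S" "distinct (enum_by mle S)"
proof -
  let ?lt = "\<lambda>a b. mle a b \<and> a \<noteq> b"
  define rank where "rank a = card {b \<in> S. mle b a}" for a
  have rank_less: "rank a < rank b" if "a \<in> S" "b \<in> S" "?lt a b" for a b
    unfolding rank_def
  proof (rule psubset_card_mono)
    show "{c \<in> S. mle c a} \<subset> {c \<in> S. mle c b}"
      using that refl antisym trans by blast
  qed (use S in simp)
  have rank_iff: "?lt a b \<longleftrightarrow> rank a < rank b" if "a \<in> S" "b \<in> S" for a b
    using that rank_less[of a b] rank_less[of b a] total[of a b] refl[of a] by fastforce
  have inj: "inj_on rank S"
    by (rule inj_onI) (metis rank_less total order_less_irrefl)
  have sorted: "sorted_wrt ?lt xs \<longleftrightarrow> sorted_wrt (<) (map rank xs)" if "set xs = S" for xs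
  proof -
    have "sorted_wrt ?lt xs \<longleftrightarrow> sorted_wrt (\<lambda>a b. rank a < rank b) xs"
      using rank_iff unfolding that[symmetric]
      by (intro iffI; elim sorted_wrt_mono_rel[rotated]) blast+
    then show ?thesis by (simp add: sorted_wrt_map)
  qed
  have "\<exists>!xs. set xs = S \<and> sorted_wrt ?lt xs"
  proof (rule ex_ex1I)
    let ?ys = "sorted_list_of_set (rank ` S)"
    let ?xs = "map (inv_into S rank) ?ys"
    have set: "set ?xs = S" using S inj by (auto simp: image_image)
    have "map rank ?xs = ?ys"
      unfolding map_map by (rule map_idI) (use S in \<open>simp add: f_inv_into_f\<close>)
    then have "sorted_wrt ?lt ?xs"
      by (simp only: sorted[OF set] strict_sorted_list_of_set)
    with set show "\<exists>xs. set xs = S \<and> sorted_wrt ?lt xs" by blast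
  next
    fix xs ys assume *: "set xs = S \<and> sorted_wrt ?lt xs" "set ys = S \<and> sorted_wrt ?lt ys"
    then have "map rank xs = map rank ys"
      using sorted by (intro strict_sorted_equal) auto
    then show "xs = ys"
      using * inj inj_on_map_eq_map[of rank xs ys] by simp
  qed
  from theI'[OF this] have *: "set (enum_by mle S) = S" "sorted_wrt ?lt (enum_by mle S)"
    unfolding enum_by_def by auto
  then show "set (enum_by mle S) = S" by simp
  have "sorted_wrt (<) (map rank (enum_by mle S))" using * sorted by simp
  then show "distinct (enum_by mle S)"
    by (metis distinct_map strict_sorted_iff)
qed

lemma finite_bounded_degree:
  assumes I: "finite I"
  shows "finite {e :: 'v \<Rightarrow>\<^sub>0 nat. Poly_Mapping.keys e \<subseteq> I \<and>
    (\<Sum>v\<in>Poly_Mapping.keys e. Poly_Mapping.lookup e v) \<le> k}" (is "finite ?S")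
proof -
  let ?B = "{g. \<forall>v. (v \<in> I \<longrightarrow> g v \<in> {..k}) \<and> (v \<notin> I \<longrightarrow> g v = 0)}"
  have "Poly_Mapping.lookup ` ?S \<subseteq> ?B"
  proof safe
    fix e :: "'v \<Rightarrow>\<^sub>0 nat" and v
    assume e: "Poly_Mapping.keys e \<subseteq> I" "(\<Sum>v\<in>Poly_Mapping.keys e. Poly_Mapping.lookup e v) \<le> k"
    show "Poly_Mapping.lookup e v \<le> k"
    proof (cases "v \<in> Poly_Mapping.keys e")
      case True
      then have "Poly_Mapping.lookup e v \<le> (\<Sum>v\<in>Poly_Mapping.keys e. Poly_Mapping.lookup e v)"
        by (intro member_le_sum) auto
      with e show ?thesis by simp
    qed (simp add: in_keys_iff)
    show "Poly_Mapping.lookup e v = 0" if "v \<notin> I"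
      using e that by (auto simp: in_keys_iff)
  qed
  moreover have "finite ?B" by (rule finite_set_of_finite_funs[OF I]) simp
  ultimately have "finite (Poly_Mapping.lookup ` ?S)" by (rule finite_subset)
  then show ?thesis by (rule finite_imageD) (auto intro: inj_onI poly_mapping_eqI)
qed

lemma finite_xvar: "finite (UNIV :: 'n::finite xvar set)"
proof -
  have "UNIV = (\<lambda>(i, j). XVar i j) ` (UNIV :: ('n \<times> 'n) set)"
  proof safe
    fix x :: "'n xvar"
    show "x \<in> range (\<lambda>(i, j). XVar i j)" by (cases x) auto
  qed simp
  then show ?thesis by (metis finite finite_imageI)
qed

lemma finite_tX_monoms_le: "finite (tX_monoms_le m k :: 'n::finite tXmonom set)"
  using finite_bounded_degree[of "Inl ` {..<m} \<union> range (Inr :: 'n xvar \<Rightarrow> _)" k]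
  by (simp add: tX_monoms_le_def tX_monoms_def finite_xvar)

text \<open>The assignment behind \<open>tX_val\<close> after specialization. It does not involve
  \<open>f\<close>, which enters only through the derivation \<open>D\<close>.\<close>

definition tX :: "(nat \<Rightarrow> 'a) \<Rightarrow> nat + 'n xvar \<Rightarrow> ('n::finite, 'a::field) ratfun" where
  "tX t v = (case v of Inl i \<Rightarrow> rconst (t i) | Inr (XVar i j) \<Rightarrow> rX i j)"

lemma (in comm_ring_hom) hom_monom_val: "hom (monom_val \<rho> e) = monom_val (\<lambda>v. hom (\<rho> v)) e"
  by (simp add: monom_val_def hom_prod hom_power)

lemma comm_ring_hom_specialize: "comm_ring_hom (specialize d f)"
  unfolding specialize_def
  by (intro comm_ring_hom.comm_ring_hom_mpol_eval comm_ring_hom_rconst)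

lemma specialize_tX_val: "specialize d f (tX_val t e) = monom_val (tX t) e"
proof -
  interpret s: comm_ring_hom "specialize d f" by (rule comm_ring_hom_specialize)
  have "specialize d f (case v of Inl i \<Rightarrow> mconst (mconst (t i)) | Inr x \<Rightarrow> mvar x) = tX t v" for v
  proof (cases v)
    case (Inl i)
    then show ?thesis by (simp add: specialize_def tX_def mpol_eval_mconst)
  next
    case (Inr x)
    have "specialize d f (mvar x) = (case x of XVar i j \<Rightarrow> rX i j)"
      unfolding specialize_def
      by (intro mpol_eval_mvar) simp_all
    with Inr show ?thesis by (simp add: tX_def)
  qed
  then show ?thesis unfolding tX_val_def s.hom_monom_val by simp
qed

text \<open>Specialization is a differential homomorphism. This is checked on generators at two
  levels: on the derivatives of the \<open>Y_ij\<close> for the coefficients, then on the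
  \<open>X_ij\<close>.\<close>

lemma specialize_deriv:
  fixes D :: "('n::finite, 'a::field) ratfun \<Rightarrow> ('n, 'a) ratfun"
  assumes d: "derivation d" and D: "derivation D"
    and Drconst: "\<And>a. D (rconst a) = rconst (d a)"
    and DX: "\<And>i j. D (rX i j) = (\<Sum>l\<in>UNIV. rconst (f i l) * rX l j)"
  shows "specialize d f (diffpolX_deriv d p) = D (specialize d f p)"
proof -
  let ?y = "\<lambda>(i, j, r). rconst ((d ^^ r) (f i j)) :: ('n, 'a) ratfun"
  let ?\<phi> = "mpol_eval rconst ?y"
  have \<phi>: "comm_ring_hom ?\<phi>" by (rule rconst.comm_ring_hom_mpol_eval)
  interpret \<phi>: comm_ring_hom ?\<phi> by fact
  interpret s: comm_ring_hom "specialize d f :: _ \<Rightarrow> ('n, 'a) ratfun" by (rule comm_ring_hom_specialize)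
  have *: "?\<phi> (diffpol_deriv d q) = D (?\<phi> q)" for q
    unfolding diffpol_deriv_def
    by (rule comm_ring_hom_mpol_deriv[OF \<phi> d D])
       (auto simp: mpol_eval_mconst mpol_eval_mvar Drconst)
  have c: "specialize d f (mconst q) = ?\<phi> q" for q
    by (simp add: specialize_def mpol_eval_mconst)
  have v: "specialize d f (mvar (XVar i j)) = rX i j" for i j
    by (simp add: specialize_def mpol_eval_mvar)
  show ?thesis
    unfolding diffpolX_deriv_def
  proof (rule comm_ring_hom_mpol_deriv[OF s.comm_ring_hom_axioms derivation_diffpol_deriv[OF d] D])
    show "specialize d f (mconst (diffpol_deriv d q)) = D (specialize d f (mconst q))" for q
      by (simp add: c *)
    show "specialize d f (case x of XVar i j \<Rightarrow> \<Sum>l\<in>UNIV. mconst (mvar (i, l, 0)) * mvar (XVar l j)) =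
        D (specialize d f (mvar x))" for x
      by (cases x) (simp add: s.hom_sum s.hom_mult c v DX mpol_eval_mvar)
  qed
qed

text \<open>A dependence among the monomials of degree at most \<open>k\<close> is a polynomial
  relation of degree at most \<open>k\<close>, and every polynomial has some degree bound.\<close>

theorem wronskians_nonzero_iff_alg_independent:
  fixes D :: "('n::finite, 'a::field) ratfun \<Rightarrow> ('n, 'a) ratfun"
    and mle :: "'n tXmonom \<Rightarrow> 'n tXmonom \<Rightarrow> bool"
  assumes d: "derivation d" and D: "derivation D"
    and Drconst: "\<And>a. D (rconst a) = rconst (d a)"
    and DX: "\<And>i j. D (rX i j) = (\<Sum>l\<in>UNIV. rconst (f i l) * rX l j)"
    and mle: "term_order_on (tX_monoms m) mle"
  shows "(\<forall>k\<ge>1. specialize d f (Wk d m t mle k) \<noteq> 0) \<longleftrightarrow>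
    alg_independent (constants D) (Inl ` {..<m} \<union> range Inr) (tX t)"
proof -
  let ?S = "tX_monoms_le m :: nat \<Rightarrow> 'n tXmonom set" and ?v = "monom_val (tX t) :: 'n tXmonom \<Rightarrow> _"
  have enum: "set (enum_by mle (?S k)) = ?S k" "distinct (enum_by mle (?S k))" for k
  proof -
    have sub: "?S k \<subseteq> tX_monoms m" by (auto simp: tX_monoms_le_def)
    show "set (enum_by mle (?S k)) = ?S k" "distinct (enum_by mle (?S k))"
      by (rule enum_by_correct[OF finite_tX_monoms_le];
          use mle sub in \<open>unfold term_order_on_def, blast\<close>)+
  qed
  have "specialize d f (Wk d m t mle k) = wronskian D (map ?v (enum_by mle (?S k)))" for k
    unfolding Wk_def
    by (subst wronskian_hom[where h = "specialize d f" and D = "diffpolX_deriv d" and D' = D])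
       (simp_all add: comm_ring_hom_specialize specialize_deriv[OF d D Drconst DX] comp_def specialize_tX_val)
  then have W: "specialize d f (Wk d m t mle k) = 0 \<longleftrightarrow> (\<exists>c. (\<forall>e\<in>?S k. c e \<in> constants D) \<and>
      (\<exists>e\<in>?S k. c e \<noteq> 0) \<and> (\<Sum>e\<in>?S k. c e * ?v e) = 0)" for k
    using wronskian_map_eq_0_iff[OF D enum(2), of ?v k] by (simp only: enum(1))
  show ?thesis
  proof
    assume nz: "\<forall>k\<ge>1. specialize d f (Wk d m t mle k) \<noteq> 0"
    show "alg_independent (constants D) (Inl ` {..<m} \<union> range Inr) (tX t)"
      unfolding alg_independent_def
    proof (intro allI impI, elim conjE)
      fix p :: "(nat + 'n xvar, ('n, 'a) ratfun) mpol"
      assume p: "\<forall>e. Poly_Mapping.lookup p e \<in> constants D"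
        "\<forall>e\<in>Poly_Mapping.keys p. Poly_Mapping.keys e \<subseteq> Inl ` {..<m} \<union> range Inr"
        "mpol_eval (\<lambda>c. c) (tX t) p = 0"
      define deg where "deg e = (\<Sum>v\<in>Poly_Mapping.keys e. Poly_Mapping.lookup e v)" for e :: "'n tXmonom"
      \<comment> \<open>\<open>insert 0\<close> covers the empty set of keys, and \<open>Suc\<close>
        ensures \<open>k \<ge> 1\<close>.\<close>
      define k where "k = Suc (Max (insert 0 (deg ` Poly_Mapping.keys p)))"
      have "deg e \<le> k" if "e \<in> Poly_Mapping.keys p" for e
        unfolding k_def using that by (intro le_SucI Max_ge) auto
      then have sub: "Poly_Mapping.keys p \<subseteq> ?S k"
        using p(2) by (auto simp: tX_monoms_le_def tX_monoms_def deg_def)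
      have "(\<Sum>e\<in>?S k. Poly_Mapping.lookup p e * ?v e) = 0"
        using p(3) mpol_eval_superset[OF _ finite_tX_monoms_le sub, of "\<lambda>c. c" "tX t"] by simp
      moreover have "specialize d f (Wk d m t mle k) \<noteq> 0" using nz by (simp add: k_def)
      ultimately have "\<forall>e\<in>?S k. Poly_Mapping.lookup p e = 0" using W[of k] p(1) by blast
      then show "p = 0"
        using sub by (metis in_keys_iff keys_eq_empty subset_iff ex_in_conv)
    qed
  next
    assume indep: "alg_independent (constants D) (Inl ` {..<m} \<union> range Inr) (tX t)"
    show "\<forall>k\<ge>1. specialize d f (Wk d m t mle k) \<noteq> 0"
    proof (intro allI impI notI)
      fix k assume "specialize d f (Wk d m t mle k) = 0"
      then obtain c where c: "\<forall>e\<in>?S k. c e \<in> constants D" "\<exists>e\<in>?S k. c e \<noteq> 0"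
        "(\<Sum>e\<in>?S k. c e * ?v e) = 0" unfolding W by blast
      define p where "p = (\<Sum>e\<in>?S k. Poly_Mapping.single e (c e))"
      have lookup: "Poly_Mapping.lookup p e = (if e \<in> ?S k then c e else 0)" for e
        by (simp add: p_def lookup_sum lookup_single when_def finite_tX_monoms_le)
      then have sub: "Poly_Mapping.keys p \<subseteq> ?S k" by (auto simp: in_keys_iff split: if_splits)
      have "mpol_eval (\<lambda>c. c) (tX t) p = (\<Sum>e\<in>?S k. Poly_Mapping.lookup p e * ?v e)"
        by (rule mpol_eval_superset[where \<phi> = "\<lambda>c. c", OF refl finite_tX_monoms_le sub])
      also have "\<dots> = 0" using c(3) by (simp add: lookup)
      finally have "mpol_eval (\<lambda>c. c) (tX t) p = 0" .
      moreover have "\<forall>e. Poly_Mapping.lookup p e \<in> constants D"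
        using c(1) derivation_zero[OF D] by (simp add: lookup constants_def)
      moreover have "\<forall>e\<in>Poly_Mapping.keys p. Poly_Mapping.keys e \<subseteq> Inl ` {..<m} \<union> range Inr"
        using sub by (auto simp: tX_monoms_le_def tX_monoms_def)
      ultimately have "p = 0" using indep unfolding alg_independent_def by blast
      then show False using c(2) lookup by (metis lookup_zero)
    qed
  qed
qed

section \<open>Constants\<close>

text \<open>Dividing by a monic linear factor over \<open>R\<close> needs no division of
  coefficients, so the quotient stays over \<open>R\<close>.\<close>

lemma is_subring_synthetic_div:
  fixes R :: "'a::comm_ring_1 set"
  assumes R: "is_subring R" and "\<forall>i. coeff p i \<in> R" "\<alpha> \<in> R"
  shows "(\<forall>i. coeff (synthetic_div p \<alpha>) i \<in> R) \<and> poly p \<alpha> \<in> R"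
  using assms(2)
proof (induction p)
  case (pCons a p)
  have "\<forall>i. coeff p i \<in> R" "a \<in> R"
    using pCons.prems by (metis coeff_pCons_Suc, metis coeff_pCons_0)
  with pCons.IH show ?case
    using is_subringD[OF R] \<open>\<alpha> \<in> R\<close> by (auto simp: coeff_pCons split: nat.split)
qed (use is_subringD[OF R] in simp)

text \<open>\<open>alg_closed_on\<close> promises just one root in \<open>K\<close>. Splitting off
  the corresponding linear factor and inducting on the degree reaches every root in the surrounding
  field.\<close>

lemma alg_closed_on_root:
  fixes p :: "'a::field poly"
  assumes K: "is_subfield K" "alg_closed_on K"
    and "p \<noteq> 0" "\<forall>i. coeff p i \<in> K" "poly p x = 0"
  shows "x \<in> K"
  using assms(3-5)
proof (induction "degree p" arbitrary: p)
  case 0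
  then show ?case by (metis degree_eq_zeroE mult_zero_right pCons_0_0 poly_0 poly_pCons add.right_neutral)
next
  case (Suc n)
  then obtain \<alpha> where \<alpha>: "\<alpha> \<in> K" "poly p \<alpha> = 0"
    using K(2) unfolding alg_closed_on_def by (metis zero_less_Suc)
  let ?q = "synthetic_div p \<alpha>"
  have p: "p = [:- \<alpha>, 1:] * ?q"
    using synthetic_div_correct'[of \<alpha> p] \<alpha> by simp
  show ?case
  proof (cases "x = \<alpha>")
    case False
    have "poly ([:- \<alpha>, 1:] * ?q) x = (x - \<alpha>) * poly ?q x" by (simp add: algebra_simps)
    then have "(x - \<alpha>) * poly ?q x = 0" unfolding p[symmetric] using Suc.prems(3) by simp
    then have "poly ?q x = 0" using False by simp
    moreover have "?q \<noteq> 0" using p Suc.prems(1) by auto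
    moreover have "n = degree ?q" using Suc.hyps(2) by (simp add: degree_synthetic_div)
    ultimately show ?thesis
      using Suc.hyps(1) is_subring_synthetic_div[OF is_subfield_imp_subring[OF K(1)] Suc.prems(2) \<alpha>(1)]
      by blast
  qed (use \<alpha> in simp)
qed

text \<open>Denominator 0 is harmless since \<open>x / 0 = 0\<close>; admitting it lets
  \<open>inverse\<close> simply swap \<open>x\<close> and \<open>y\<close>.\<close>

lemma is_subfield_fractions:
  assumes R: "is_subring R"
  shows "is_subfield {x / y | x y. x \<in> R \<and> y \<in> R}"
proof -
  define Q where "Q = {x / y | x y. x \<in> R \<and> y \<in> R}"
  have I: "a \<in> Q" if "a = x / y" "x \<in> R" "y \<in> R" for a x y
    using that unfolding Q_def by blast
  have RQ: "x \<in> Q" if "x \<in> R" for x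
    by (rule I[of _ x 1]) (use that is_subringD(2)[OF R] in auto)
  have sum_prod: "a + b \<in> Q \<and> a * b \<in> Q" if a: "a \<in> Q" and b: "b \<in> Q" for a b
  proof -
    obtain x y where xy: "a = x / y" "x \<in> R" "y \<in> R" using a unfolding Q_def by blast
    obtain x' y' where xy': "b = x' / y'" "x' \<in> R" "y' \<in> R" using b unfolding Q_def by blast
    have "a * b \<in> Q"
      by (rule I[of _ "x * x'" "y * y'"]) (use xy xy' is_subringD(4)[OF R] in auto)
    moreover have "a + b \<in> Q"
    proof (cases "y = 0 \<or> y' = 0")
      case True
      then have "a + b = a \<or> a + b = b" using xy(1) xy'(1) by auto
      then show ?thesis using a b by metis
    next
      case False
      then have "a + b = (x * y' + x' * y) / (y * y')" by (simp add: xy xy' add_frac_eq)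
      then show ?thesis
        by (rule I) (use xy xy' is_subringD(3,4)[OF R] in auto)
    qed
    ultimately show ?thesis by blast
  qed
  have neg_inv: "- a \<in> Q \<and> inverse a \<in> Q" if a: "a \<in> Q" for a
  proof -
    obtain x y where xy: "a = x / y" "x \<in> R" "y \<in> R" using a unfolding Q_def by blast
    have "- a \<in> Q" by (rule I[of _ "- x" y]) (use xy is_subringD(5)[OF R] in auto)
    moreover have "inverse a \<in> Q" by (rule I[of _ y x]) (use xy in auto)
    ultimately show ?thesis by blast
  qed
  show ?thesis
    unfolding is_subfield_def is_subring_def Q_def[symmetric]
    using RQ[OF is_subringD(1)[OF R]] RQ[OF is_subringD(2)[OF R]] sum_prod neg_inv
    by (intro conjI ballI) blast+
qed

lemma common_denominator:
  assumes R: "is_subring R" and "finite A" "\<And>i. i \<in> A \<Longrightarrow> g i \<in> {x / y | x y. x \<in> R \<and> y \<in> R}"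
  shows "\<exists>y\<in>R. y \<noteq> 0 \<and> (\<forall>i\<in>A. y * (g i :: 'a::field) \<in> R)"
  using assms(2,3)
proof (induction A rule: finite_induct)
  case empty
  then show ?case using is_subringD(2)[OF R] by (intro bexI[of _ 1]) auto
next
  case (insert j A)
  then obtain y where y: "y \<in> R" "y \<noteq> 0" "\<forall>i\<in>A. y * g i \<in> R" by auto
  obtain u v where uv: "g j = u / v" "u \<in> R" "v \<in> R" using insert.prems[of j] by blast
  show ?case
  proof (cases "v = 0")
    \<comment> \<open>Here \<open>g j = u / 0 = 0\<close>, so the old denominator still
      works.\<close>
    case True
    then show ?thesis using y uv is_subringD(1)[OF R] by (intro bexI[of _ y]) auto
  next
    case False
    have "v * y * g j = y * u" using False uv by simp
    moreover have "v * y * g i = v * (y * g i)" for i by simp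
    ultimately have "\<forall>i\<in>insert j A. v * y * g i \<in> R"
      using y uv is_subringD(4)[OF R] by (metis insert_iff)
    then show ?thesis using y uv False is_subringD(4)[OF R] by (intro bexI[of _ "v * y"]) auto
  qed
qed

lemma lookup_mult_mconst:
  "Poly_Mapping.lookup (p * mconst c) e = Poly_Mapping.lookup p e * (c :: 'a::comm_ring_1)"
proof -
  have "p * mconst c = (\<Sum>e\<in>Poly_Mapping.keys p. Poly_Mapping.single e (Poly_Mapping.lookup p e * c))"
    by (subst mpol_sum_single[of p, symmetric])
       (simp add: sum_distrib_right mult_single mconst_def)
  then show ?thesis
    by (auto simp: lookup_sum lookup_single when_def in_keys_iff)
qed

lemma comm_ring_hom_mpol_eval_id: "comm_ring_hom (mpol_eval (\<lambda>c. c) \<rho>)"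
  by (rule comm_ring_hom.comm_ring_hom_mpol_eval) (unfold_locales; simp)

text \<open>This set is the ring generated over \<open>K\<close> by the \<open>\<rho> v\<close> with
  \<open>v \<in> I\<close>; its fractions contain the subfield so generated, which allows
  denominators to be cleared.\<close>

lemma is_subring_mpol_eval:
  fixes \<rho> :: "'v \<Rightarrow> 'a::comm_ring_1"
  assumes K: "is_subring K"
  shows "is_subring {mpol_eval (\<lambda>c. c) \<rho> p | p. (\<forall>e. Poly_Mapping.lookup p e \<in> K) \<and>
    (\<forall>e\<in>Poly_Mapping.keys p. Poly_Mapping.keys e \<subseteq> I)}"
proof -
  define P where "P p \<longleftrightarrow> (\<forall>e. Poly_Mapping.lookup p e \<in> K) \<and>
    (\<forall>e\<in>Poly_Mapping.keys p. Poly_Mapping.keys e \<subseteq> I)" for p :: "('v, 'a) mpol"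
  have add: "P (p + q)" if "P p" "P q" for p q
  proof -
    have "\<forall>e. Poly_Mapping.lookup (p + q) e \<in> K"
      using that is_subringD(3)[OF K] by (simp add: P_def lookup_add)
    then show ?thesis using that keys_add[of p q] unfolding P_def by blast
  qed
  have neg: "P (- p)" if "P p" for p
  proof -
    have "Poly_Mapping.keys (- p) = Poly_Mapping.keys p" by (auto simp: in_keys_iff lookup_uminus)
    then show ?thesis using that is_subringD(5)[OF K] unfolding P_def by (simp add: lookup_uminus)
  qed
  have single: "P (Poly_Mapping.single e c)" if "c \<in> K" "Poly_Mapping.keys e \<subseteq> I" for e c
  proof -
    have "Poly_Mapping.keys (Poly_Mapping.single e c) \<subseteq> {e}" by simp
    then show ?thesis using that is_subringD(1)[OF K]
      unfolding P_def by (auto simp: lookup_single when_def)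
  qed
  have sum: "P (sum p A)" if "\<And>x. x \<in> A \<Longrightarrow> P (p x)" for p and A :: "('v \<Rightarrow>\<^sub>0 nat) set"
    using that
  proof (induction A rule: infinite_finite_induct)
    case (insert x A)
    then show ?case by (simp add: add)
  qed (use single[of 0 0] is_subringD(1)[OF K] in simp_all)
  have mult: "P (p * q)" if "P p" "P q" for p q
  proof -
    have "p * q = (\<Sum>e\<in>Poly_Mapping.keys p. \<Sum>e'\<in>Poly_Mapping.keys q.
        Poly_Mapping.single (e + e') (Poly_Mapping.lookup p e * Poly_Mapping.lookup q e'))"
      unfolding mult_single[symmetric] sum_product[symmetric] mpol_sum_single ..
    moreover have "Poly_Mapping.keys (e + e') \<subseteq> I"
      if "e \<in> Poly_Mapping.keys p" "e' \<in> Poly_Mapping.keys q" for e e'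
      using that \<open>P p\<close> \<open>P q\<close> keys_add[of e e'] unfolding P_def by blast
    moreover have "Poly_Mapping.lookup p e * Poly_Mapping.lookup q e' \<in> K" for e e'
      using that is_subringD(4)[OF K] by (simp add: P_def)
    ultimately show ?thesis by (simp only: sum single)
  qed
  have 1: "P 1" "P 0" using single[of 1 0] single[of 0 0] is_subringD(1,2)[OF K] by simp_all
  define R where "R = {mpol_eval (\<lambda>c. c) \<rho> p | p. P p}"
  have I: "mpol_eval (\<lambda>c. c) \<rho> p \<in> R" if "P p" for p
    using that unfolding R_def by blast
  have E: "\<exists>p. P p \<and> x = mpol_eval (\<lambda>c. c) \<rho> p" if "x \<in> R" for x
    using that unfolding R_def by blast
  interpret ev: comm_ring_hom "mpol_eval (\<lambda>c. c) \<rho>" by (rule comm_ring_hom_mpol_eval_id)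
  have "x + y \<in> R \<and> x * y \<in> R" if "x \<in> R" "y \<in> R" for x y
  proof -
    obtain p q where "P p" "P q" "x = mpol_eval (\<lambda>c. c) \<rho> p" "y = mpol_eval (\<lambda>c. c) \<rho> q"
      using E[OF \<open>x \<in> R\<close>] E[OF \<open>y \<in> R\<close>] by blast
    then show ?thesis using I[OF add, of p q] I[OF mult, of p q] by (simp add: ev.hom_add ev.hom_mult)
  qed
  moreover have "- x \<in> R" if x: "x \<in> R" for x
  proof -
    obtain p where "P p" "x = mpol_eval (\<lambda>c. c) \<rho> p" using E[OF x] by blast
    then show ?thesis using I[OF neg, of p] by (simp add: ev.hom_uminus)
  qed
  moreover have "0 \<in> R" "1 \<in> R" using I[OF 1(2)] I[OF 1(1)] by simp_all
  ultimately have "is_subring R" unfolding is_subring_def by blast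
  then show ?thesis unfolding R_def P_def .
qed

text \<open>A constant satisfies a polynomial equation over the ring generated by \<open>K\<close> and the \<open>\<rho> v\<close>;
  by algebraic independence over the constants it holds separately for each monomial in the
  \<open>\<rho> v\<close>, which yields an equation over \<open>K\<close>.\<close>

lemma algebraic_over_of_alg_independent:
  fixes \<rho> :: "'v \<Rightarrow> 'a::field"
  assumes K: "is_subfield K" and C: "is_subfield C" "K \<subseteq> C"
    and indep: "alg_independent C I \<rho>"
    and c: "c \<in> C" "algebraic_over (is_subfield hull (K \<union> \<rho> ` I)) c"
  shows "algebraic_over K c"
proof -
  let ?ev = "mpol_eval (\<lambda>c. c) \<rho>"
  interpret ev: comm_ring_hom ?ev by (rule comm_ring_hom_mpol_eval_id)
  define P where "P p \<longleftrightarrow> (\<forall>e. Poly_Mapping.lookup p e \<in> K) \<and>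
    (\<forall>e\<in>Poly_Mapping.keys p. Poly_Mapping.keys e \<subseteq> I)" for p :: "('v, 'a) mpol"
  define R where "R = {?ev p | p. P p}"
  have R: "is_subring R"
    using is_subring_mpol_eval[OF is_subfield_imp_subring[OF K]] unfolding R_def P_def .
  have RQ: "x \<in> {x / y | x y. x \<in> R \<and> y \<in> R}" if "x \<in> R" for x
    using that is_subringD(2)[OF R] by (intro CollectI exI[of _ x] exI[of _ 1]) simp
  have "K \<subseteq> R"
  proof
    fix k assume "k \<in> K"
    then have "P (mconst k)" using is_subfieldD(1)[OF K]
      unfolding P_def mconst_def by (auto simp: lookup_single when_def)
    then show "k \<in> R" unfolding R_def by (auto simp: mpol_eval_mconst intro!: exI[of _ "mconst k"])
  qed
  moreover have "\<rho> v \<in> R" if "v \<in> I" for v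
  proof -
    have "P (mvar v)" using is_subfieldD(1,2)[OF K] that
      unfolding P_def mvar_def by (auto simp: lookup_single when_def)
    then show ?thesis unfolding R_def by (auto simp: mpol_eval_mvar intro!: exI[of _ "mvar v"])
  qed
  ultimately have hull: "is_subfield hull (K \<union> \<rho> ` I) \<subseteq> {x / y | x y. x \<in> R \<and> y \<in> R}"
    by (intro hull_minimal is_subfield_fractions[OF R]) (use RQ in blast)
  obtain p where p: "p \<noteq> 0" "\<forall>i. coeff p i \<in> is_subfield hull (K \<union> \<rho> ` I)" "poly p c = 0"
    using c(2) unfolding algebraic_over_def by blast
  let ?n = "degree p"
  have "coeff p i \<in> {x / y | x y. x \<in> R \<and> y \<in> R}" for i
    by (rule subsetD[OF hull]) (use p(2) in simp)
  then have "\<exists>y\<in>R. y \<noteq> 0 \<and> (\<forall>i\<in>{..?n}. y * coeff p i \<in> R)"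
    by (intro common_denominator[OF R finite_atMost])
  then obtain y where y: "y \<noteq> 0" "\<forall>i\<in>{..?n}. y * coeff p i \<in> R" by (elim bexE conjE)
  then have "\<forall>i\<in>{..?n}. \<exists>q. P q \<and> y * coeff p i = ?ev q" by (auto simp: R_def)
  then obtain q where q: "\<And>i. i \<le> ?n \<Longrightarrow> P (q i)" "\<And>i. i \<le> ?n \<Longrightarrow> y * coeff p i = ?ev (q i)"
    unfolding bchoice_iff by auto
  \<comment> \<open>The powers of \<open>c\<close> are absorbed into the coefficients. They lie in
    \<open>C\<close> because \<open>c\<close> does, so independence over \<open>C\<close> applies to
    \<open>Q\<close> although it would not apply to a relation with \<open>c\<close> as an extra
    variable.\<close>
  define Q where "Q = (\<Sum>i\<le>?n. q i * mconst (c ^ i))"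
  have lookup_Q: "Poly_Mapping.lookup Q e = (\<Sum>i\<le>?n. Poly_Mapping.lookup (q i) e * c ^ i)" for e
    by (simp add: Q_def lookup_sum lookup_mult_mconst)
  have "?ev Q = (\<Sum>i\<le>?n. y * coeff p i * c ^ i)"
    by (simp add: Q_def ev.hom_sum ev.hom_mult q(2) mpol_eval_mconst)
  also have "\<dots> = 0"
    using p(3) by (simp add: poly_altdef mult.assoc flip: sum_distrib_left)
  finally have "?ev Q = 0" .
  moreover have "\<forall>e. Poly_Mapping.lookup Q e \<in> C"
    unfolding lookup_Q using q(1) C c(1) is_subring_power[OF is_subfield_imp_subring[OF C(1)]]
    by (auto intro!: is_subfield_sum[OF C(1)] is_subfieldD(4)[OF C(1)] simp: P_def)
  moreover have "\<forall>e\<in>Poly_Mapping.keys Q. Poly_Mapping.keys e \<subseteq> I"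
  proof
    fix e assume "e \<in> Poly_Mapping.keys Q"
    then have "(\<Sum>i\<le>?n. Poly_Mapping.lookup (q i) e * c ^ i) \<noteq> 0"
      by (simp add: in_keys_iff lookup_Q)
    then obtain i where "i \<le> ?n" "Poly_Mapping.lookup (q i) e \<noteq> 0"
      by (metis (no_types, lifting) atMost_iff mult_zero_left sum.neutral)
    then show "Poly_Mapping.keys e \<subseteq> I" using q(1) by (auto simp: P_def in_keys_iff)
  qed
  ultimately have "Q = 0" using indep unfolding alg_independent_def by blast
  \<comment> \<open>The leading coefficient of \<open>p\<close> stays nonzero after clearing
    denominators; a monomial \<open>e\<close> occurring in it guarantees that the equation read off
    at \<open>e\<close> is nontrivial.\<close>
  have "q ?n \<noteq> 0" using q(2)[of ?n] y(1) p(1) by auto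
  then obtain e where e: "Poly_Mapping.lookup (q ?n) e \<noteq> 0"
    by (metis poly_mapping_eqI lookup_zero)
  define r where "r = (\<Sum>i\<le>?n. monom (Poly_Mapping.lookup (q i) e) i)"
  have cf: "coeff r i = (if i \<le> ?n then Poly_Mapping.lookup (q i) e else 0)" for i
    by (simp add: r_def coeff_sum)
  have "poly r c = Poly_Mapping.lookup Q e"
    by (simp add: r_def poly_sum poly_monom lookup_Q)
  then have "poly r c = 0" using \<open>Q = 0\<close> by simp
  moreover have "r \<noteq> 0" using cf[of ?n] e by auto
  moreover have "\<forall>i. coeff r i \<in> K" using q(1) is_subfieldD(1)[OF K] by (auto simp: cf P_def)
  ultimately show ?thesis unfolding algebraic_over_def by blast
qed

section \<open>Independence and algebraicity of the \<open>t_i\<close> and \<open>X_ij\<close> in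
  the field of rational functions\<close>

lemma lookup_map_key_sum:
  fixes e :: "('u + 'v) \<Rightarrow>\<^sub>0 nat"
  shows lookup_map_key_Inl: "Poly_Mapping.lookup (Poly_Mapping.map_key Inl e) u = Poly_Mapping.lookup e (Inl u)"
    and lookup_map_key_Inr: "Poly_Mapping.lookup (Poly_Mapping.map_key Inr e) v = Poly_Mapping.lookup e (Inr v)"
  by (simp_all add: map_key.rep_eq)

lemma monom_val_split:
  fixes e :: "('u + 'v) \<Rightarrow>\<^sub>0 nat"
  shows "monom_val \<rho> e = monom_val (\<lambda>u. \<rho> (Inl u)) (Poly_Mapping.map_key Inl e) *
    monom_val (\<lambda>v. \<rho> (Inr v)) (Poly_Mapping.map_key Inr e)"
proof -
  let ?A = "Poly_Mapping.keys (Poly_Mapping.map_key Inl e)" and ?B = "Poly_Mapping.keys (Poly_Mapping.map_key Inr e)"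
  have "v \<in> Inl ` ?A \<union> Inr ` ?B" if "v \<in> Poly_Mapping.keys e" for v
    using that by (cases v) (auto simp: in_keys_iff lookup_map_key_sum)
  then have "monom_val \<rho> e = (\<Prod>v\<in>Inl ` ?A \<union> Inr ` ?B. \<rho> v ^ Poly_Mapping.lookup e v)"
    by (intro monom_val_superset) auto
  also have "\<dots> = (\<Prod>v\<in>Inl ` ?A. \<rho> v ^ Poly_Mapping.lookup e v) * (\<Prod>v\<in>Inr ` ?B. \<rho> v ^ Poly_Mapping.lookup e v)"
    by (rule prod.union_disjoint) auto
  also have "\<dots> = monom_val (\<lambda>u. \<rho> (Inl u)) (Poly_Mapping.map_key Inl e) *
      monom_val (\<lambda>v. \<rho> (Inr v)) (Poly_Mapping.map_key Inr e)"
    by (simp add: prod.reindex monom_val_def lookup_map_key_sum)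
  finally show ?thesis .
qed

lemma to_fract_single:
  "to_fract (Poly_Mapping.single r c) = rconst c * monom_val (\<lambda>x. case x of XVar i j \<Rightarrow> rX i j) r"
  unfolding to_fract_eq_mpol_eval by (rule mpol_eval_single) simp

text \<open>Collecting a relation by its \<open>X\<close>-monomials gives a polynomial in genuine
  variables, so each collected coefficient vanishes. Each of these is a polynomial in the
  \<open>t_i\<close> over \<open>K\<close>, to which \<open>indep\<close> applies.\<close>

lemma alg_independent_tX:
  fixes t :: "nat \<Rightarrow> 'a::field"
  assumes K: "is_subring K" and indep: "alg_independent K I t"
  shows "alg_independent (rconst ` K) (Inl ` I \<union> range Inr)
    (tX t :: nat + 'n xvar \<Rightarrow> ('n::finite, 'a) ratfun)"
  unfolding alg_independent_def
proof (intro allI impI, elim conjE)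
  fix p :: "(nat + 'n xvar, ('n, 'a) ratfun) mpol"
  assume p: "\<forall>e. Poly_Mapping.lookup p e \<in> rconst ` K"
    "\<forall>e\<in>Poly_Mapping.keys p. Poly_Mapping.keys e \<subseteq> Inl ` I \<union> range Inr"
    "mpol_eval (\<lambda>c. c) (tX t) p = 0"
  define l :: "'n tXmonom \<Rightarrow> _" where "l = Poly_Mapping.map_key Inl"
  define r :: "'n tXmonom \<Rightarrow> _" where "r = Poly_Mapping.map_key Inr"
  have lr: "e = e'" if "l e = l e'" "r e = r e'" for e e'
  proof (rule poly_mapping_eqI)
    fix v show "Poly_Mapping.lookup e v = Poly_Mapping.lookup e' v"
      using that by (cases v) (auto simp: l_def r_def simp flip: lookup_map_key_sum)
  qed
  have "\<forall>e. \<exists>a. a \<in> K \<and> Poly_Mapping.lookup p e = rconst a" using p(1) by blast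
  then obtain g where g: "\<And>e. g e \<in> K" "\<And>e. Poly_Mapping.lookup p e = rconst (g e)"
    using choice[of "\<lambda>e a. a \<in> K \<and> Poly_Mapping.lookup p e = rconst a"] by blast
  let ?E = "Poly_Mapping.keys p"
  define P :: "('n xvar, 'a) mpol" where
    "P = (\<Sum>e\<in>?E. Poly_Mapping.single (r e) (g e * monom_val t (l e)))"
  interpret tf: comm_ring_hom "to_fract :: ('n xvar, 'a) mpol \<Rightarrow> _" by (rule comm_ring_hom_to_fract)
  have "to_fract P = (\<Sum>e\<in>?E. Poly_Mapping.lookup p e * monom_val (tX t) e)"
    unfolding P_def tf.hom_sum
  proof (rule sum.cong[OF refl])
    fix e
    have "monom_val (\<lambda>v. tX t (Inr v)) (r e) =
        (monom_val (\<lambda>x. case x of XVar i j \<Rightarrow> rX i j) (r e) :: ('n, 'a) ratfun)"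
      by (simp add: tX_def)
    moreover have "monom_val (\<lambda>u. tX t (Inl u)) (l e) = (rconst (monom_val t (l e)) :: ('n, 'a) ratfun)"
      by (simp add: tX_def rconst.hom_monom_val)
    ultimately show "to_fract (Poly_Mapping.single (r e) (g e * monom_val t (l e))) =
        Poly_Mapping.lookup p e * monom_val (tX t) e"
      unfolding monom_val_split[of "tX t" e] l_def[symmetric] r_def[symmetric]
      by (simp add: to_fract_single g(2) rconst.hom_mult mult.assoc)
  qed
  then have "P = 0" using p(3) by (simp add: mpol_eval_def)
  have "Poly_Mapping.lookup p e0 = 0" for e0
  proof (cases "e0 \<in> ?E")
    case True
    \<comment> \<open>All exponents sharing the \<open>X\<close>-part of \<open>e0\<close>; within
      this set the \<open>t\<close>-part determines the exponent, so no two terms of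
      \<open>q\<close> merge.\<close>
    define E0 where "E0 = {e \<in> ?E. r e = r e0}"
    have fin: "finite E0" by (simp add: E0_def)
    define q where "q = (\<Sum>e\<in>E0. Poly_Mapping.single (l e) (g e))"
    have P0: "Poly_Mapping.lookup P (r e0) = (\<Sum>e\<in>E0. g e * monom_val t (l e))"
      unfolding P_def E0_def lookup_sum
      by (simp add: lookup_single when_def sum.inter_filter)
    interpret ev: comm_ring_hom "mpol_eval (\<lambda>c. c) t" by (rule comm_ring_hom_mpol_eval_id)
    have "mpol_eval (\<lambda>c. c) t q = (\<Sum>e\<in>E0. g e * monom_val t (l e))"
      unfolding q_def ev.hom_sum by (simp add: mpol_eval_single)
    then have q0: "mpol_eval (\<lambda>c. c) t q = 0" using P0 \<open>P = 0\<close> by simp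
    have qK: "\<forall>e. Poly_Mapping.lookup q e \<in> K"
      unfolding q_def lookup_sum using g(1) is_subringD(1)[OF K]
      by (auto intro!: is_subring_sum[OF K] simp: lookup_single when_def)
    have "\<forall>e\<in>Poly_Mapping.keys q. Poly_Mapping.keys e \<subseteq> I"
    proof
      fix e' assume "e' \<in> Poly_Mapping.keys q"
      then have "(\<Sum>e\<in>E0. Poly_Mapping.lookup (Poly_Mapping.single (l e) (g e)) e') \<noteq> 0"
        by (simp add: in_keys_iff q_def lookup_sum)
      then obtain e where e: "e \<in> E0" "Poly_Mapping.lookup (Poly_Mapping.single (l e) (g e)) e' \<noteq> 0"
        by (rule sum.not_neutral_contains_not_neutral)
      then have "e' = l e" by (auto simp: lookup_single when_def split: if_splits)
      moreover have "Poly_Mapping.keys e \<subseteq> Inl ` I \<union> range Inr" using e p(2) by (auto simp: E0_def)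
      moreover have "Inl x \<in> Poly_Mapping.keys e" if "x \<in> Poly_Mapping.keys (l e)" for x
        using that by (simp add: l_def in_keys_iff lookup_map_key_sum)
      ultimately show "Poly_Mapping.keys e' \<subseteq> I" by blast
    qed
    then have "q = 0"
      using indep[unfolded alg_independent_def, THEN spec, THEN mp, OF conjI[OF qK conjI[OF _ q0]]] by simp
    have "0 = Poly_Mapping.lookup q (l e0)" by (simp add: \<open>q = 0\<close>)
    also have "\<dots> = (\<Sum>e\<in>E0. if e = e0 then g e else 0)"
      unfolding q_def lookup_sum
      by (rule sum.cong) (auto simp: lookup_single when_def E0_def dest: lr)
    also have "\<dots> = g e0" using fin True by (simp add: E0_def)
    finally show ?thesis by (simp add: g(2))
  qed (simp add: in_keys_iff)
  then show "p = 0" by (simp add: poly_mapping_eqI)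
qed

lemma algebraic_over_hom_image:
  fixes h :: "'a::field \<Rightarrow> 'b::field"
  assumes "comm_ring_hom h" and inj: "inj h" and "h ` K \<subseteq> L" "algebraic_over K x"
  shows "algebraic_over L (h x)"
proof -
  interpret comm_ring_hom h by fact
  obtain p where p: "p \<noteq> 0" "\<forall>i. coeff p i \<in> K" "poly p x = 0"
    using assms(4) unfolding algebraic_over_def by blast
  let ?q = "\<Sum>i\<le>degree p. monom (h (coeff p i)) i"
  have cf: "coeff ?q i = h (coeff p i)" for i
    by (auto simp: coeff_sum coeff_eq_0)
  have "poly ?q (h x) = h (\<Sum>i\<le>degree p. coeff p i * x ^ i)"
    by (simp add: poly_sum poly_monom hom_sum hom_mult hom_power)
  also have "\<dots> = 0" using p(3) by (simp flip: poly_altdef)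
  finally have "poly ?q (h x) = 0" .
  moreover have "?q \<noteq> 0"
    using p(1) cf inj by (metis coeff_0 hom_zero injD leading_coeff_0_iff)
  moreover have "\<forall>i. coeff ?q i \<in> L" using p(2) assms(3) unfolding cf by blast
  ultimately show ?thesis unfolding algebraic_over_def by blast
qed

lemma alg_closed_on_rconst_image:
  assumes "alg_closed_on K"
  shows "alg_closed_on (rconst ` K :: ('n::finite, 'a::field) ratfun set)"
  unfolding alg_closed_on_def
proof (intro allI impI, elim conjE)
  fix p :: "('n, 'a) ratfun poly"
  assume p: "\<forall>i. coeff p i \<in> rconst ` K" "0 < degree p"
  then have "\<forall>i. \<exists>a. a \<in> K \<and> coeff p i = rconst a" by blast
  then obtain g where g: "\<And>i. g i \<in> K" "\<And>i. coeff p i = rconst (g i)"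
    using choice[of "\<lambda>i a. a \<in> K \<and> coeff p i = rconst a"] by blast
  let ?q = "\<Sum>i\<le>degree p. monom (g i) i"
  have g0: "g i = 0" if "i > degree p" for i
    using coeff_eq_0[OF that] g(2)[of i] by simp
  have cf: "coeff ?q i = g i" for i by (auto simp: coeff_sum g0)
  have "coeff ?q (degree p) \<noteq> 0" using cf[of "degree p"] g(2)[of "degree p"] p(2)
    by (metis degree_0 leading_coeff_0_iff less_irrefl rconst.hom_zero)
  then have "degree ?q > 0" using p(2) le_degree by fastforce
  moreover have "\<forall>i. coeff ?q i \<in> K" unfolding cf using g(1) by blast
  ultimately obtain x where x: "x \<in> K" "poly ?q x = 0" using assms unfolding alg_closed_on_def by blast
  have "poly p (rconst x) = rconst (poly ?q x)"
    by (simp add: poly_altdef[of p] g(2) poly_sum poly_monom rconst.hom_sum rconst.hom_mult rconst.hom_power)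
  then show "\<exists>y\<in>rconst ` K. poly p y = 0" using x by auto
qed

text \<open>The elements algebraic over \<open>C(t_i, X_ij)\<close> form a subfield. Its preimage in
  \<open>F\<close> is a ring containing \<open>C(t_i)\<close> and the \<open>z_i\<close>, hence all
  of \<open>F\<close>; the \<open>X_ij\<close> belong to it trivially.\<close>

lemma ratfun_algebraic_over:
  fixes t z :: "nat \<Rightarrow> 'a::field"
  assumes K: "is_subfield K"
    and z: "\<forall>i<q. algebraic_over (is_subfield hull (K \<union> t ` I)) (z i)"
    and gen: "is_subring hull ((is_subfield hull (K \<union> t ` I)) \<union> z ` {..<q}) = UNIV"
  shows "algebraic_over (is_subfield hull (rconst ` K \<union> tX t ` (Inl ` I \<union> range Inr)))
    (x :: ('n::finite, 'a) ratfun)"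
proof -
  let ?G = "rconst ` K \<union> tX t ` (Inl ` I \<union> range Inr) :: ('n, 'a) ratfun set"
  let ?L = "is_subfield hull ?G"
  have L: "is_subfield ?L" by (rule is_subfield_hull)
  let ?A = "{x. algebraic_over ?L x}"
  have A: "is_subfield ?A" by (rule is_subfield_algebraic[OF L])
  have "is_subfield (rconst -` ?L :: 'a set)"
    using is_subfieldD[OF L] is_subfield_inverse[OF L]
    by (simp add: is_subfield_def is_subring_def rconst.hom_add rconst.hom_mult rconst.hom_uminus rconst_inverse)
  moreover have "tX t (Inl i) \<in> ?L" if "i \<in> I" for i
    by (rule hull_inc) (use that in auto)
  then have "K \<union> t ` I \<subseteq> rconst -` ?L"
    using hull_subset[of ?G is_subfield] by (auto simp: tX_def)
  ultimately have F0: "is_subfield hull (K \<union> t ` I) \<subseteq> rconst -` ?L" by (intro hull_minimal)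
  have "is_subring (rconst -` ?A :: 'a set)"
    using is_subfieldD[OF A]
    by (simp add: is_subring_def rconst.hom_add rconst.hom_mult rconst.hom_uminus)
  moreover have "is_subfield hull (K \<union> t ` I) \<subseteq> rconst -` ?A"
    using F0 algebraic_over_self[OF L] by auto
  moreover have "z ` {..<q} \<subseteq> rconst -` ?A"
  proof safe
    fix i assume "i < q"
    then show "z i \<in> rconst -` ?A"
      using algebraic_over_hom_image[OF comm_ring_hom_rconst, of "is_subfield hull (K \<union> t ` I)" ?L "z i"]
        z F0 by (auto simp: inj_def)
  qed
  ultimately have "is_subring hull ((is_subfield hull (K \<union> t ` I)) \<union> z ` {..<q}) \<subseteq> rconst -` ?A"
    by (intro hull_minimal[of _ _ is_subring] Un_least[of _ "rconst -` ?A"])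
  then have "range rconst \<subseteq> ?A" unfolding gen by auto
  moreover have "rX i j \<in> ?A" for i j
  proof -
    have "tX t (Inr (XVar i j)) \<in> ?L" by (rule hull_inc) auto
    then have "algebraic_over ?L (tX t (Inr (XVar i j)))" by (rule algebraic_over_self[OF L])
    moreover have "tX t (Inr (XVar i j)) = (rX i j :: ('n, 'a) ratfun)" by (simp add: tX_def)
    ultimately show ?thesis by simp
  qed
  ultimately have "?A = UNIV" by (rule subfield_ratfun_UNIV[OF A])
  then show ?thesis by auto
qed

lemma alg_independent_mono:
  fixes \<rho> :: "'v \<Rightarrow> 'a::field"
  assumes indep: "alg_independent C I \<rho>" and "K \<subseteq> C"
  shows "alg_independent K I \<rho>"
  unfolding alg_independent_def
proof (intro allI impI, elim conjE)
  fix p :: "('v, 'a) mpol"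
  assume p: "\<forall>e. Poly_Mapping.lookup p e \<in> K"
    "\<forall>e\<in>Poly_Mapping.keys p. Poly_Mapping.keys e \<subseteq> I" "mpol_eval (\<lambda>c. c) \<rho> p = 0"
  have "\<forall>e. Poly_Mapping.lookup p e \<in> C" using p(1) \<open>K \<subseteq> C\<close> by auto
  then show "p = 0"
    using indep[unfolded alg_independent_def, THEN spec, THEN mp, OF conjI[OF _ conjI[OF p(2,3)]]] by simp
qed

theorem alg_independent_iff_no_new_constants:
  fixes t z :: "nat \<Rightarrow> 'a::field"
    and D :: "('n::finite, 'a) ratfun \<Rightarrow> ('n, 'a) ratfun"
  assumes d: "derivation d" and D: "derivation D"
    and Drconst: "\<And>a. D (rconst a) = rconst (d a)"
    and closed: "alg_closed_on (constants d)"
    and indep: "alg_independent (constants d) {..<m} t"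
    and z: "\<forall>i<q. algebraic_over (is_subfield hull (constants d \<union> t ` {..<m})) (z i)"
    and gen: "is_subring hull ((is_subfield hull (constants d \<union> t ` {..<m})) \<union> z ` {..<q}) = UNIV"
  shows "alg_independent (constants D) (Inl ` {..<m} \<union> range Inr) (tX t) \<longleftrightarrow>
    constants D \<subseteq> range rconst"
proof
  assume *: "constants D \<subseteq> range rconst"
  have "constants D \<subseteq> rconst ` constants d"
  proof
    fix c assume c: "c \<in> constants D"
    then obtain a where a: "c = rconst a" using * by auto
    then have "d a = 0" using c Drconst[of a] by (simp add: constants_def)
    then show "c \<in> rconst ` constants d" using a by (simp add: constants_def)
  qed
  moreover have "alg_independent (rconst ` constants d) (Inl ` {..<m} \<union> range Inr) (tX t :: nat + 'n xvar \<Rightarrow> _)"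
    by (rule alg_independent_tX[OF is_subfield_imp_subring[OF is_subfield_constants[OF d]] indep])
  ultimately show "alg_independent (constants D) (Inl ` {..<m} \<union> range Inr) (tX t)"
    by (rule alg_independent_mono[rotated])
next
  assume indepD: "alg_independent (constants D) (Inl ` {..<m} \<union> range Inr) (tX t)"
  have K: "is_subfield (constants d)" by (rule is_subfield_constants[OF d])
  have "c \<in> rconst ` constants d" if "c \<in> constants D" for c
  proof -
    have "algebraic_over (rconst ` constants d) c"
      by (rule algebraic_over_of_alg_independent[OF rconst_image_subfield[OF K]
            is_subfield_constants[OF D] _ indepD that ratfun_algebraic_over[OF K z gen]])
         (auto simp: constants_def Drconst)
    then show ?thesis
      unfolding algebraic_over_def
      using alg_closed_on_root[OF rconst_image_subfield[OF K] alg_closed_on_rconst_image[OF closed]]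
      by blast
  qed
  then show "constants D \<subseteq> range rconst" by auto
qed

section \<open>The Galois group\<close>

definition mmap :: "('a \<Rightarrow> 'b) \<Rightarrow> 'a ^ 'n ^ 'm \<Rightarrow> 'b ^ 'n ^ 'm" where
  "mmap h A = (\<chi> i j. h (A $ i $ j))"

lemma mmap_nth [simp]: "Finite_Cartesian_Product.vec_nth (Finite_Cartesian_Product.vec_nth (mmap h A) i) j =
    h (Finite_Cartesian_Product.vec_nth (Finite_Cartesian_Product.vec_nth A i) j)"
  by (simp add: mmap_def)

lemma (in comm_ring_hom) mmap_mult: "mmap hom (A ** B) = mmap hom A ** mmap hom B"
  by (simp add: Finite_Cartesian_Product.vec_eq_iff matrix_matrix_mult_def hom_sum hom_mult)

lemma (in comm_ring_hom) mmap_one: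
  "mmap hom (Finite_Cartesian_Product.mat 1) = Finite_Cartesian_Product.mat 1"
  by (simp add: Finite_Cartesian_Product.vec_eq_iff Finite_Cartesian_Product.mat_def)

lemma (in comm_ring_hom) hom_mat_det:
  "hom (Determinants.det A) = Determinants.det (mmap hom A)"
proof -
  have "hom (of_int (sign p)) = of_int (sign p)" for p :: "'c \<Rightarrow> 'c"
    by (simp add: sign_def hom_uminus)
  then show ?thesis by (simp add: Determinants.det_def hom_sum hom_mult hom_prod)
qed

lemma mmap_derivation_mult:
  assumes "derivation D"
  shows "mmap D (A ** B) = mmap D A ** B + A ** mmap D B"
  using assms
  by (simp add: Finite_Cartesian_Product.vec_eq_iff matrix_matrix_mult_def derivation_sum
      sum.distrib derivation_def)

lemma mmap_derivation_one:
  fixes D :: "'a::ring_1 \<Rightarrow> 'a"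
  assumes "derivation D"
  shows "mmap D (Finite_Cartesian_Product.mat 1) = 0"
  using derivation_zero[OF assms] derivation_one[OF assms]
  by (simp add: Finite_Cartesian_Product.vec_eq_iff Finite_Cartesian_Product.mat_def)

section \<open>The generic matrix and its linear substitutions\<close>

abbreviation (input) rXmat :: "('n::finite, 'a::field) ratfun ^ 'n ^ 'n" where
  "rXmat \<equiv> \<chi> i j. rX i j"

text \<open>The generic determinant is a nonzero polynomial because it takes the value 1 at the
  identity matrix.\<close>

lemma rXmat_invertible:
  obtains Y :: "('n::finite, 'a::field) ratfun ^ 'n ^ 'n"
  where "Y ** rXmat = Finite_Cartesian_Product.mat 1" "rXmat ** Y = Finite_Cartesian_Product.mat 1"
proof -
  let ?V = "(\<chi> i j. mvar (XVar i j)) :: ('n xvar, 'a) mpol ^ 'n ^ 'n"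
  let ?ev = "mpol_eval (\<lambda>c. c) (\<lambda>x. case x of XVar i j \<Rightarrow> if i = j then 1 else 0) :: ('n xvar, 'a) mpol \<Rightarrow> 'a"
  interpret ev: comm_ring_hom ?ev by (rule comm_ring_hom_mpol_eval_id)
  interpret tf: comm_ring_hom "to_fract :: ('n xvar, 'a) mpol \<Rightarrow> _" by (rule comm_ring_hom_to_fract)
  have "mmap ?ev ?V = Finite_Cartesian_Product.mat 1"
    by (simp add: Finite_Cartesian_Product.vec_eq_iff Finite_Cartesian_Product.mat_def mpol_eval_mvar)
  then have "?ev (Determinants.det ?V) = 1" by (simp add: ev.hom_mat_det)
  then have "Determinants.det ?V \<noteq> 0" by auto
  moreover have "mmap to_fract ?V = rXmat"
    by (simp add: Finite_Cartesian_Product.vec_eq_iff rX_def)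
  then have "to_fract (Determinants.det ?V) = Determinants.det (rXmat :: ('n, 'a) ratfun ^ 'n ^ 'n)"
    by (simp add: tf.hom_mat_det)
  ultimately have "Determinants.det (rXmat :: ('n, 'a) ratfun ^ 'n ^ 'n) \<noteq> 0" by (metis to_fract_eq_0_iff)
  then have "invertible (rXmat :: ('n, 'a) ratfun ^ 'n ^ 'n)" by (simp add: invertible_det_nz)
  then show ?thesis using that unfolding invertible_def by blast
qed

text \<open>The substitution of \<open>X M\<close> for \<open>X\<close> is defined on polynomials.
  The substitution for the inverse matrix makes it injective, as the extension to fractions
  requires, and the extended maps are mutually inverse.\<close>

lemma right_mult_automorphism:
  fixes M M' :: "('n::finite, 'a::field) ratfun ^ 'n ^ 'n"
  assumes M: "M \<in> mats_over (range rconst)" "M' \<in> mats_over (range rconst)"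
    and inv: "M ** M' = Finite_Cartesian_Product.mat 1" "M' ** M = Finite_Cartesian_Product.mat 1"
  shows "\<exists>\<sigma>. comm_ring_hom \<sigma> \<and> bij \<sigma> \<and> (\<forall>a. \<sigma> (rconst a) = rconst a) \<and> mmap \<sigma> rXmat = rXmat ** M"
proof -
  have N: "\<exists>N. A = mmap rconst N" if "A \<in> mats_over (range rconst)"
    for A :: "('n, 'a) ratfun ^ 'n ^ 'n"
  proof -
    have "\<forall>i j. \<exists>a. A $ i $ j = rconst a" using that by (auto simp: mats_over_def)
    then obtain g where "\<forall>i j. A $ i $ j = rconst (g i j)" by metis
    then show ?thesis by (intro exI[of _ "\<chi> i j. g i j"]) (simp add: Finite_Cartesian_Product.vec_eq_iff)
  qed
  define s where "s N = mpol_eval mconst (\<lambda>x. case x of XVar i j \<Rightarrow>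
      \<Sum>l\<in>UNIV. mvar (XVar i l) * mconst (N $ l $ j))"
    for N :: "'a ^ 'n ^ 'n"
  have s_hom: "comm_ring_hom (s N)" for N :: "'a ^ 'n ^ 'n"
    unfolding s_def by (rule comm_ring_hom.comm_ring_hom_mpol_eval[OF comm_ring_hom_mconst])
  interpret mc: comm_ring_hom "mconst :: 'a \<Rightarrow> ('n xvar, 'a) mpol" by (rule comm_ring_hom_mconst)
  have s_const: "s N (mconst c) = mconst c" for N :: "'a ^ 'n ^ 'n" and c
    by (simp add: s_def mpol_eval_mconst)
  have s_var: "s N (mvar (XVar i j)) = (\<Sum>l\<in>UNIV. mvar (XVar i l) * mconst (N $ l $ j))" for N i j
    by (simp add: s_def mpol_eval_mvar)
  \<comment> \<open>\<open>s N'\<close> sends \<open>X N\<close> to \<open>X N' N\<close>, so the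
    left inverse of \<open>s N\<close> comes from a left inverse of \<open>N\<close>.\<close>
  have s_inv: "s N' (s N p) = p" if "N' ** N = Finite_Cartesian_Product.mat 1"
    for N N' :: "'a ^ 'n ^ 'n" and p
  proof -
    interpret sN: comm_ring_hom "s N" by (rule s_hom)
    interpret sN': comm_ring_hom "s N'" by (rule s_hom)
    have var: "s N' (s N (mvar (XVar i j))) = mvar (XVar i j)" for i j
    proof -
      have "s N' (s N (mvar (XVar i j))) =
          (\<Sum>l\<in>UNIV. \<Sum>k\<in>UNIV. mvar (XVar i k) * (mconst (N' $ k $ l) * mconst (N $ l $ j)))"
        by (simp add: s_var s_const sN'.hom_sum sN'.hom_mult sum_distrib_right mult.assoc)
      also have "\<dots> = (\<Sum>k\<in>UNIV. mvar (XVar i k) * mconst ((N' ** N) $ k $ j))"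
        by (subst sum.swap)
           (simp add: matrix_matrix_mult_def mc.hom_sum mc.hom_mult sum_distrib_left)
      also have "\<dots> = (\<Sum>k\<in>UNIV. if k = j then mvar (XVar i k) else 0)"
        unfolding that by (rule sum.cong) (auto simp: Finite_Cartesian_Product.mat_def)
      finally show ?thesis by simp
    qed
    have "comm_ring_hom (\<lambda>p. s N' (s N p))"
      by unfold_locales (simp_all add: sN.hom_add sN'.hom_add sN.hom_mult sN'.hom_mult)
    moreover have "comm_ring_hom (\<lambda>p :: ('n xvar, 'a) mpol. p)" by unfold_locales simp_all
    ultimately show ?thesis
    proof (rule comm_ring_hom_mpol_eqI)
      show "s N' (s N (mvar v)) = mvar v" for v using var by (cases v) simp
    qed (simp add: s_const)
  qed
  interpret tf: comm_ring_hom "to_fract :: ('n xvar, 'a) mpol \<Rightarrow> _" by (rule comm_ring_hom_to_fract)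
  have ext: "\<exists>\<sigma>. comm_ring_hom \<sigma> \<and> (\<forall>a. \<sigma> (rconst a) = rconst a) \<and> mmap \<sigma> rXmat = rXmat ** mmap rconst N"
    if NN: "N' ** N = Finite_Cartesian_Product.mat 1" for N N' :: "'a ^ 'n ^ 'n"
  proof -
    interpret sN: comm_ring_hom "s N" by (rule s_hom)
    define h :: "('n xvar, 'a) mpol \<Rightarrow> ('n, 'a) ratfun" where "h p = to_fract (s N p)" for p
    have "comm_ring_hom h"
      by unfold_locales (simp_all add: h_def sN.hom_add sN.hom_mult)
    moreover have "p = 0" if "h p = 0" for p
    proof -
      have "s N p = 0" using that by (simp add: h_def)
      then have "s N' (s N p) = s N' 0" by simp
      also have "s N' 0 = 0" by (simp add: s_def)
      finally show ?thesis by (simp add: s_inv[OF NN])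
    qed
    ultimately obtain \<sigma> where \<sigma>: "comm_ring_hom \<sigma>" "\<And>p. \<sigma> (to_fract p) = to_fract (s N p)"
      using fract_hom_extension[of h] unfolding h_def by metis
    have "\<sigma> (rX i j) = (\<Sum>l\<in>UNIV. rX i l * rconst (N $ l $ j))" for i j
      by (simp add: rX_def \<sigma>(2) s_var tf.hom_sum rconst_def)
    then have "mmap \<sigma> rXmat = rXmat ** mmap rconst N"
      by (simp add: Finite_Cartesian_Product.vec_eq_iff matrix_matrix_mult_def)
    then show ?thesis using \<sigma> s_const by (auto simp: rconst_def)
  qed
  obtain N N' where NM: "M = mmap rconst N" "M' = mmap rconst N'" using N M by blast
  have inj: "A = Finite_Cartesian_Product.mat 1"
    if "mmap rconst A = (Finite_Cartesian_Product.mat 1 :: ('n, 'a) ratfun ^ 'n ^ 'n)" for A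
    using that unfolding rconst.mmap_one[symmetric] by (simp add: Finite_Cartesian_Product.vec_eq_iff)
  have NN: "N ** N' = Finite_Cartesian_Product.mat 1" "N' ** N = Finite_Cartesian_Product.mat 1"
    using inv unfolding NM by (auto intro: inj simp: rconst.mmap_mult)
  obtain \<sigma> where \<sigma>: "comm_ring_hom \<sigma>" "\<And>a. \<sigma> (rconst a) = rconst a" "mmap \<sigma> rXmat = rXmat ** M"
    using ext[OF NN(2)] unfolding NM(1)[symmetric] by blast
  obtain \<tau> where \<tau>: "comm_ring_hom \<tau>" "\<And>a. \<tau> (rconst a) = rconst a" "mmap \<tau> rXmat = rXmat ** M'"
    using ext[OF NN(1)] unfolding NM(2)[symmetric] by blast
  have id: "\<alpha> \<circ> \<beta> = id"
    if \<alpha>: "comm_ring_hom \<alpha>" "\<And>a. \<alpha> (rconst a) = rconst a" "mmap \<alpha> rXmat = rXmat ** A"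
      and \<beta>: "comm_ring_hom \<beta>" "\<And>a. \<beta> (rconst a) = rconst a" "mmap \<beta> rXmat = rXmat ** mmap rconst B"
      and AB: "A ** mmap rconst B = Finite_Cartesian_Product.mat 1"
    for \<alpha> \<beta> :: "('n, 'a) ratfun \<Rightarrow> ('n, 'a) ratfun" and A B
  proof -
    interpret \<alpha>: comm_ring_hom \<alpha> by fact
    interpret \<beta>: comm_ring_hom \<beta> by fact
    have "mmap \<alpha> (mmap \<beta> rXmat) = rXmat ** A ** mmap rconst B"
      unfolding \<beta>(3) \<alpha>.mmap_mult \<alpha>(3)
      by (simp add: mmap_def \<alpha>(2))
    then have "mmap \<alpha> (mmap \<beta> rXmat) = rXmat"
      by (simp add: matrix_mul_assoc[symmetric] AB)
    then have "\<alpha> (\<beta> (rX i j)) = rX i j" for i j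
      by (simp add: Finite_Cartesian_Product.vec_eq_iff)
    note X = this
    have "(\<lambda>x. \<alpha> (\<beta> x)) = (\<lambda>x. x)"
    proof (rule ratfun_hom_eqI)
      show "comm_ring_hom (\<lambda>x. \<alpha> (\<beta> x))"
        by unfold_locales (simp_all add: \<alpha>.hom_add \<beta>.hom_add \<alpha>.hom_mult \<beta>.hom_mult)
      show "comm_ring_hom (\<lambda>x :: ('n, 'a) ratfun. x)" by unfold_locales simp_all
    qed (simp_all only: \<alpha>(2) \<beta>(2) X)
    then show ?thesis by (simp add: fun_eq_iff)
  qed
  have "\<sigma> \<circ> \<tau> = id"
    by (rule id[OF \<sigma> \<tau>(1,2), of N']) (use \<tau>(3) inv(1) NM(2) in simp_all)
  moreover have "\<tau> \<circ> \<sigma> = id"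
    by (rule id[OF \<tau> \<sigma>(1,2), of N]) (use \<sigma>(3) inv(2) NM(1) in simp_all)
  ultimately have "bij \<sigma>" by (intro o_bij)
  with \<sigma> show ?thesis by blast
qed

lemma ratfun_hom_deriv_commute:
  fixes D :: "('n::finite, 'a::field) ratfun \<Rightarrow> ('n, 'a) ratfun"
  assumes \<sigma>: "comm_ring_hom \<sigma>" and D: "derivation D"
    and "\<And>a. \<sigma> (D (rconst a)) = D (\<sigma> (rconst a))" "\<And>i j. \<sigma> (D (rX i j)) = D (\<sigma> (rX i j))"
  shows "\<sigma> (D x) = D (\<sigma> x)"
proof -
  interpret \<sigma>: comm_ring_hom \<sigma> by fact
  have inverse: "\<sigma> (inverse x) = inverse (\<sigma> x)" for x
    using field_hom_divide[OF \<sigma>, of 1 x] by (simp add: inverse_eq_divide)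
  have D': "D (x + y) = D x + D y" "D (x * y) = D x * y + x * D y" for x y
    using D by (auto simp: derivation_def)
  have "is_subfield {x. \<sigma> (D x) = D (\<sigma> x)}"
    by (auto simp: is_subfield_def is_subring_def derivation_zero[OF D] derivation_one[OF D]
        D' derivation_uminus[OF D] derivation_inverse[OF D] \<sigma>.hom_add \<sigma>.hom_mult \<sigma>.hom_uminus
        inverse field_hom_divide[OF \<sigma>] \<sigma>.hom_power)
  from subfield_ratfun_UNIV[OF this] show ?thesis using assms(3,4) by blast
qed

lemma comm_ring_homI:
  fixes h :: "'a::comm_ring_1 \<Rightarrow> 'b::comm_ring_1"
  assumes "\<And>x y. h (x + y) = h x + h y" "\<And>x y. h (x * y) = h x * h y" "h 1 = 1"
  shows "comm_ring_hom h"
proof -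
  have "h 0 = 0" using assms(1)[of 0 0] by simp
  then show ?thesis by unfold_locales (use assms in auto)
qed

lemma in_diff_aut_group_iff:
  "\<sigma> \<in> carrier (diff_aut_group D F) \<longleftrightarrow>
    comm_ring_hom \<sigma> \<and> bij \<sigma> \<and> (\<forall>x. \<sigma> (D x) = D (\<sigma> x)) \<and> (\<forall>x\<in>F. \<sigma> x = x)"
proof -
  have "comm_ring_hom \<sigma> \<longleftrightarrow>
      \<sigma> 1 = 1 \<and> (\<forall>x y. \<sigma> (x + y) = \<sigma> x + \<sigma> y) \<and> (\<forall>x y. \<sigma> (x * y) = \<sigma> x * \<sigma> y)"
  proof
    assume "comm_ring_hom \<sigma>"
    then interpret comm_ring_hom \<sigma> .
    show "\<sigma> 1 = 1 \<and> (\<forall>x y. \<sigma> (x + y) = \<sigma> x + \<sigma> y) \<and> (\<forall>x y. \<sigma> (x * y) = \<sigma> x * \<sigma> y)"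
      by (simp add: hom_add hom_mult)
  qed (auto intro: comm_ring_homI)
  then show ?thesis by (auto simp: diff_aut_group_def)
qed

lemma matrix_mult_add_rdistrib: "(A + B) ** C = A ** C + B ** (C :: 'a::semiring_1 ^ 'n ^ 'm)"
  by (simp add: Finite_Cartesian_Product.vec_eq_iff matrix_matrix_mult_def distrib_right sum.distrib)

lemma mmap_rXmat_eq_iff:
  "mmap \<sigma> rXmat = A \<longleftrightarrow> (\<forall>i j. \<sigma> (rX i j) = A $ i $ j)"
  by (simp add: Finite_Cartesian_Product.vec_eq_iff)

section \<open>The Picard-Vessiot property and its group in the absence of new constants\<close>

context
  fixes d :: "'a::field \<Rightarrow> 'a" and f :: "'n::finite \<Rightarrow> 'n \<Rightarrow> 'a"
    and D :: "('n, 'a) ratfun \<Rightarrow> ('n, 'a) ratfun"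
  assumes d: "derivation d" and D: "derivation D"
    and Drconst: "\<And>a. D (rconst a) = rconst (d a)"
    and DX: "\<And>i j. D (rX i j) = (\<Sum>l\<in>UNIV. rconst (f i l) * rX l j)"
    and no_new_constants: "constants D \<subseteq> range rconst"
begin

lemma mmap_D_rXmat: "mmap D rXmat = mmap rconst (\<chi> i j. f i j) ** rXmat"
  by (simp add: Finite_Cartesian_Product.vec_eq_iff matrix_matrix_mult_def DX)

text \<open>With \<open>A\<close> the matrix of the \<open>f i j\<close>, both \<open>X\<close> and
  its image \<open>Z\<close> solve \<open>D Z = A Z\<close>, while \<open>Y = X^-1\<close> satisfies
  \<open>D Y = - Y A\<close>. Hence \<open>D (Y Z) = 0\<close>.\<close>

lemma diff_aut_group_matrix:
  assumes \<sigma>: "\<sigma> \<in> carrier (diff_aut_group D (range rconst))"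
  obtains M where "M \<in> carrier (GL_group (constants D))" "mmap \<sigma> rXmat = rXmat ** M"
proof -
  interpret \<sigma>: comm_ring_hom \<sigma> using \<sigma> by (simp add: in_diff_aut_group_iff)
  have \<sigma>D: "\<sigma> (D x) = D (\<sigma> x)" and \<sigma>F: "\<sigma> (rconst a) = rconst a" for x a
    using \<sigma> by (auto simp: in_diff_aut_group_iff)
  have mmap_\<sigma>D: "mmap D (mmap \<sigma> A) = mmap \<sigma> (mmap D A)" for A :: "('n, 'a) ratfun ^ 'n ^ 'n"
    by (simp add: mmap_def \<sigma>D)
  let ?F = "mmap rconst (\<chi> i j. f i j) :: ('n, 'a) ratfun ^ 'n ^ 'n"
  have \<sigma>_F: "mmap \<sigma> ?F = ?F" by (simp add: mmap_def \<sigma>F)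
  obtain Y :: "('n, 'a) ratfun ^ 'n ^ 'n"
    where Y: "Y ** rXmat = Finite_Cartesian_Product.mat 1" "rXmat ** Y = Finite_Cartesian_Product.mat 1"
    by (rule rXmat_invertible)
  define Z where "Z = mmap \<sigma> rXmat"
  define W where "W = mmap \<sigma> Y"
  have ZW: "Z ** W = Finite_Cartesian_Product.mat 1" "W ** Z = Finite_Cartesian_Product.mat 1"
    unfolding Z_def W_def \<sigma>.mmap_mult[symmetric] Y by (rule \<sigma>.mmap_one)+
  have "0 = mmap D (Y ** rXmat)"
    unfolding Y by (rule mmap_derivation_one[OF D, symmetric])
  also have "\<dots> = (mmap D Y + Y ** ?F) ** rXmat"
    unfolding mmap_derivation_mult[OF D] mmap_D_rXmat
    by (simp add: matrix_mult_add_rdistrib matrix_mul_assoc)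
  finally have "0 = (mmap D Y + Y ** ?F) ** rXmat ** Y" by simp
  then have DY: "mmap D Y + Y ** ?F = 0"
    by (simp add: matrix_mul_assoc[symmetric] Y)
  have "mmap D W + W ** ?F = mmap \<sigma> (mmap D Y + Y ** ?F)"
    unfolding W_def mmap_\<sigma>D
    by (simp add: Finite_Cartesian_Product.vec_eq_iff matrix_matrix_mult_def \<sigma>.hom_add \<sigma>.hom_sum \<sigma>.hom_mult \<sigma>F)
  then have DW: "mmap D W + W ** ?F = 0"
    unfolding DY by (simp add: Finite_Cartesian_Product.vec_eq_iff)
  have DZ: "mmap D Z = ?F ** Z"
    unfolding Z_def mmap_\<sigma>D mmap_D_rXmat \<sigma>.mmap_mult \<sigma>_F ..
  have "mmap D (Y ** Z) = (mmap D Y + Y ** ?F) ** Z"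
    unfolding mmap_derivation_mult[OF D] DZ by (simp add: matrix_mult_add_rdistrib matrix_mul_assoc)
  then have YZ: "Y ** Z \<in> mats_over (constants D)"
    unfolding DY by (simp add: Finite_Cartesian_Product.vec_eq_iff mats_over_def constants_def)
  \<comment> \<open>\<open>GL_group\<close> also demands an inverse with constant entries; the same
    cancellation, with \<open>W = Z^-1\<close> in place of \<open>Y\<close>, provides it.\<close>
  have "mmap D (W ** rXmat) = (mmap D W + W ** ?F) ** rXmat"
    unfolding mmap_derivation_mult[OF D] mmap_D_rXmat by (simp add: matrix_mult_add_rdistrib matrix_mul_assoc)
  then have WX: "W ** rXmat \<in> mats_over (constants D)"
    unfolding DW by (simp add: Finite_Cartesian_Product.vec_eq_iff mats_over_def constants_def)
  have "(Y ** Z) ** (W ** rXmat) = Y ** (Z ** W) ** rXmat" by (simp add: matrix_mul_assoc)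
  then have 1: "(Y ** Z) ** (W ** rXmat) = Finite_Cartesian_Product.mat 1" by (simp add: ZW Y)
  have "(W ** rXmat) ** (Y ** Z) = W ** (rXmat ** Y) ** Z" by (simp add: matrix_mul_assoc)
  then have 2: "(W ** rXmat) ** (Y ** Z) = Finite_Cartesian_Product.mat 1" by (simp add: ZW Y)
  have "mmap \<sigma> rXmat = rXmat ** (Y ** Z)"
    by (simp add: matrix_mul_assoc Y Z_def)
  moreover have "Y ** Z \<in> carrier (GL_group (constants D))"
    using YZ WX 1 2 by (auto simp: GL_group_def)
  ultimately show ?thesis using that by blast
qed

text \<open>Absence of new constants puts \<open>M\<close> over \<open>F\<close>, so the
  substitution automorphism exists and fixes \<open>M\<close>. It commutes with \<open>D\<close>
  because \<open>D (X M) = (D X) M\<close> for constant \<open>M\<close>.\<close>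

lemma matrix_diff_aut_group:
  assumes M: "M \<in> carrier (GL_group (constants D))"
  shows "\<exists>\<sigma>. \<sigma> \<in> carrier (diff_aut_group D (range rconst)) \<and> mmap \<sigma> rXmat = rXmat ** M"
proof -
  obtain M' where M': "M' \<in> mats_over (constants D)"
      "M ** M' = Finite_Cartesian_Product.mat 1" "M' ** M = Finite_Cartesian_Product.mat 1"
    and "M \<in> mats_over (constants D)"
    using M by (auto simp: GL_group_def)
  then have Mc: "M $ i $ j \<in> constants D" for i j by (simp add: mats_over_def)
  have "M \<in> mats_over (range rconst)" "M' \<in> mats_over (range rconst)"
    using M' Mc no_new_constants by (auto simp: mats_over_def)
  then obtain \<sigma> where \<sigma>: "comm_ring_hom \<sigma>" "bij \<sigma>" "\<And>a. \<sigma> (rconst a) = rconst a"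
      "mmap \<sigma> rXmat = rXmat ** M"
    using right_mult_automorphism[OF _ _ M'(2,3)] by blast
  interpret \<sigma>: comm_ring_hom \<sigma> by (rule \<sigma>(1))
  have \<sigma>X: "\<sigma> (rX i j) = (\<Sum>k\<in>UNIV. rX i k * M $ k $ j)" for i j
    using \<sigma>(4) by (simp add: mmap_rXmat_eq_iff matrix_matrix_mult_def)
  have "\<sigma> (D x) = D (\<sigma> x)" for x
  proof (rule ratfun_hom_deriv_commute[OF \<sigma>(1) D])
    fix i j
    have "\<sigma> (D (rX i j)) = (\<Sum>l\<in>UNIV. \<Sum>k\<in>UNIV. rconst (f i l) * rX l k * M $ k $ j)"
      by (simp add: DX \<sigma>.hom_sum \<sigma>.hom_mult \<sigma>(3) \<sigma>X sum_distrib_left mult.assoc)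
    also have "\<dots> = (\<Sum>k\<in>UNIV. D (rX i k) * M $ k $ j)"
      by (subst sum.swap) (simp add: DX sum_distrib_right)
    also have "\<dots> = (\<Sum>k\<in>UNIV. D (rX i k * M $ k $ j))"
      using D Mc by (simp add: derivation_def constants_def)
    also have "\<dots> = D (\<sigma> (rX i j))"
      by (simp add: \<sigma>X derivation_sum[OF D])
    finally show "\<sigma> (D (rX i j)) = D (\<sigma> (rX i j))" .
  qed (simp add: Drconst \<sigma>(3))
  then have "\<sigma> \<in> carrier (diff_aut_group D (range rconst))"
    using \<sigma> by (auto simp: in_diff_aut_group_iff)
  then show ?thesis using \<sigma>(4) by blast
qed

lemma galois_iso:
  "\<exists>\<Phi> \<in> iso (GL_group (constants D)) (diff_aut_group D (range rconst)).
     \<forall>M \<in> carrier (GL_group (constants D)). mmap (\<Phi> M) rXmat = rXmat ** M"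
proof -
  let ?G = "GL_group (constants D) :: (('n, 'a) ratfun ^ 'n ^ 'n) monoid"
  let ?A = "diff_aut_group D (range rconst)"
  obtain \<Phi> where \<Phi>: "\<And>M. M \<in> carrier ?G \<Longrightarrow> \<Phi> M \<in> carrier ?A"
      "\<And>M. M \<in> carrier ?G \<Longrightarrow> mmap (\<Phi> M) rXmat = rXmat ** M"
    using matrix_diff_aut_group by metis
  have unique: "\<sigma> = \<tau>"
    if "\<sigma> \<in> carrier ?A" "\<tau> \<in> carrier ?A" "mmap \<sigma> rXmat = mmap \<tau> rXmat" for \<sigma> \<tau>
    by (rule ratfun_hom_eqI)
       (use that in \<open>auto simp: in_diff_aut_group_iff Finite_Cartesian_Product.vec_eq_iff\<close>)
  have cancel: "M = N" if "rXmat ** M = rXmat ** N" for M N :: "('n, 'a) ratfun ^ 'n ^ 'n"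
  proof -
    obtain Y :: "('n, 'a) ratfun ^ 'n ^ 'n" where Y: "Y ** rXmat = Finite_Cartesian_Product.mat 1"
      by (rule rXmat_invertible)
    have "Y ** (rXmat ** M) = Y ** (rXmat ** N)" using that by simp
    then show ?thesis by (simp add: matrix_mul_assoc Y)
  qed
  have closed: "M ** N \<in> carrier ?G" if M: "M \<in> carrier ?G" and N: "N \<in> carrier ?G" for M N
  proof -
    have mult: "A ** B \<in> mats_over (constants D)"
      if "A \<in> mats_over (constants D)" "B \<in> mats_over (constants D)" for A B :: "('n, 'a) ratfun ^ 'n ^ 'n"
      using that is_subfield_constants[OF D]
      by (auto simp: mats_over_def matrix_matrix_mult_def intro!: is_subfield_sum is_subfieldD)
    obtain M' N' where M': "M' \<in> mats_over (constants D)" "M ** M' = Finite_Cartesian_Product.mat 1"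
        "M' ** M = Finite_Cartesian_Product.mat 1" and N': "N' \<in> mats_over (constants D)"
        "N ** N' = Finite_Cartesian_Product.mat 1" "N' ** N = Finite_Cartesian_Product.mat 1"
      using M N unfolding GL_group_def by auto
    have "(M ** N) ** (N' ** M') = M ** (N ** N') ** M'" "(N' ** M') ** (M ** N) = N' ** (M' ** M) ** N"
      by (simp_all add: matrix_mul_assoc)
    then have "(M ** N) ** (N' ** M') = Finite_Cartesian_Product.mat 1"
        "(N' ** M') ** (M ** N) = Finite_Cartesian_Product.mat 1"
      by (simp_all add: M' N')
    then show ?thesis using mult M N M'(1) N'(1) unfolding GL_group_def by auto
  qed
  have "\<Phi> \<in> hom ?G ?A"
  proof (rule homI)
    fix M N assume M: "M \<in> carrier ?G" and N: "N \<in> carrier ?G"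
    interpret \<sigma>: comm_ring_hom "\<Phi> M" using \<Phi>(1)[OF M] by (simp add: in_diff_aut_group_iff)
    interpret \<tau>: comm_ring_hom "\<Phi> N" using \<Phi>(1)[OF N] by (simp add: in_diff_aut_group_iff)
    \<comment> \<open>Automorphisms fix \<open>N\<close> entrywise, so \<open>\<Phi> M\<close> sends
      \<open>X N\<close> to \<open>X M N\<close>. This is why right multiplication gives a
      homomorphism rather than an antihomomorphism.\<close>
    have "N \<in> mats_over (range rconst)"
      using N no_new_constants by (auto simp: GL_group_def mats_over_def)
    moreover have "\<Phi> M x = x" if "x \<in> range rconst" for x
      using \<Phi>(1)[OF M] that by (auto simp: in_diff_aut_group_iff)
    ultimately have "mmap (\<Phi> M) N = N"
      by (simp add: Finite_Cartesian_Product.vec_eq_iff mats_over_def)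
    then have "mmap (\<Phi> M) (mmap (\<Phi> N) rXmat) = rXmat ** (M ** N)"
      using \<Phi>(2)[OF M] \<Phi>(2)[OF N] by (simp add: \<sigma>.mmap_mult matrix_mul_assoc)
    moreover have "mmap (\<Phi> M \<circ> \<Phi> N) rXmat = mmap (\<Phi> M) (mmap (\<Phi> N) rXmat)"
      by (simp add: mmap_def)
    moreover have "\<Phi> M \<circ> \<Phi> N \<in> carrier ?A"
    proof -
      have "comm_ring_hom (\<Phi> M \<circ> \<Phi> N)"
        by (rule comm_ring_homI) (simp_all add: \<sigma>.hom_add \<tau>.hom_add \<sigma>.hom_mult \<tau>.hom_mult)
      then show ?thesis
        using \<Phi>(1)[OF M] \<Phi>(1)[OF N] by (auto simp: in_diff_aut_group_iff intro: bij_comp)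
    qed
    ultimately have "\<Phi> (M ** N) = \<Phi> M \<circ> \<Phi> N"
      using \<Phi>(1)[OF closed[OF M N]] \<Phi>(2)[OF closed[OF M N]] by (intro unique) simp_all
    then show "\<Phi> (M \<otimes>\<^bsub>?G\<^esub> N) = \<Phi> M \<otimes>\<^bsub>?A\<^esub> \<Phi> N"
      by (simp add: GL_group_def diff_aut_group_def)
  qed (rule \<Phi>(1))
  moreover have "bij_betw \<Phi> (carrier ?G) (carrier ?A)"
  proof (rule bij_betwI')
    show "\<Phi> M = \<Phi> N \<longleftrightarrow> M = N" if "M \<in> carrier ?G" "N \<in> carrier ?G" for M N
      using \<Phi>(2)[OF that(1)] \<Phi>(2)[OF that(2)] cancel by metis
    show "\<exists>M\<in>carrier ?G. \<sigma> = \<Phi> M" if \<sigma>: "\<sigma> \<in> carrier ?A" for \<sigma>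
    proof -
      obtain M where M: "M \<in> carrier ?G" "mmap \<sigma> rXmat = rXmat ** M"
        by (rule diff_aut_group_matrix[OF \<sigma>])
      then have "\<sigma> = \<Phi> M" using \<Phi>[OF M(1)] \<sigma> by (intro unique) simp_all
      then show ?thesis using M(1) by blast
    qed
  qed (rule \<Phi>(1))
  ultimately show ?thesis
    using \<Phi>(2) by (intro bexI[of _ \<Phi>]) (auto simp: iso_def)
qed

text \<open>\<open>D\<^sup>r X = A\<^sub>r X\<close> with \<open>A\<^sub>r\<close> over \<open>F\<close>.  The \<open>n\<^sup>2 + 1\<close> matrices \<open>A\<^sub>0, \<dots>, A\<^bsub>n\<^sup>2\<^esub>\<close> are linearly
  dependent over \<open>F\<close>; the leading coefficient of a dependence cannot have index below \<open>n\<^sup>2\<close>,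
  since the \<open>n\<^sup>2\<close> functions \<open>X\<^sub>i\<^sub>j\<close> are linearly independent over the constants.\<close>

primrec Acoeff :: "nat \<Rightarrow> 'n \<Rightarrow> 'n \<Rightarrow> 'a" where
  "Acoeff 0 i l = (if i = l then 1 else 0)"
| "Acoeff (Suc r) i l = d (Acoeff r i l) + (\<Sum>k\<in>UNIV. Acoeff r i k * f k l)"

lemma funpow_D_rX: "(D ^^ r) (rX i j) = (\<Sum>l\<in>UNIV. rconst (Acoeff r i l) * rX l j)"
proof (induction r)
  case 0
  have "(\<Sum>l\<in>UNIV. rconst (Acoeff 0 i l) * rX l j) = (\<Sum>l\<in>UNIV. if l = i then rX l j else 0)"
    by (rule sum.cong) auto
  then show ?case by simp
next
  case (Suc r)
  have "D (rconst a * x) = rconst (d a) * x + rconst a * D x" for a x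
    using D by (simp add: derivation_def Drconst)
  then have "(D ^^ Suc r) (rX i j) = (\<Sum>l\<in>UNIV. rconst (d (Acoeff r i l)) * rX l j) +
      (\<Sum>k\<in>UNIV. \<Sum>l\<in>UNIV. rconst (Acoeff r i k * f k l) * rX l j)"
    by (simp add: Suc derivation_sum[OF D] sum.distrib DX sum_distrib_left rconst.hom_mult mult.assoc)
  also have "(\<Sum>k\<in>UNIV. \<Sum>l\<in>UNIV. rconst (Acoeff r i k * f k l) * rX l j) =
      (\<Sum>l\<in>UNIV. rconst (\<Sum>k\<in>UNIV. Acoeff r i k * f k l) * rX l j)"
    by (subst sum.swap) (simp add: rconst.hom_sum sum_distrib_right)
  finally show ?case
    by (simp add: sum.distrib[symmetric] rconst.hom_add distrib_right)
qed

text \<open>Constants lie in \<open>F\<close>, so the relation is a linear form over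
  \<open>F\<close> in the variables, and its coefficients can be read off.\<close>

lemma rX_independent:
  assumes c: "\<And>i j. c (i, j) \<in> constants D" and sum: "(\<Sum>(i, j)\<in>UNIV. c (i, j) * rX i j) = 0"
  shows "c (i, j) = 0"
proof -
  have "\<forall>p. \<exists>a. c p = rconst a" using c no_new_constants by (metis rangeE subsetD surj_pair)
  then obtain g where g: "\<And>p. c p = rconst (g p)" by metis
  interpret tf: comm_ring_hom "to_fract :: ('n xvar, 'a) mpol \<Rightarrow> _" by (rule comm_ring_hom_to_fract)
  define p :: "('n xvar, 'a) mpol" where
    "p = (\<Sum>q\<in>UNIV. Poly_Mapping.single (Poly_Mapping.single (XVar (fst q) (snd q)) 1) (g q))"
  have "to_fract p = (\<Sum>(i, j)\<in>UNIV. c (i, j) * rX i j)"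
    unfolding tf.hom_sum p_def by (rule sum.cong) (auto simp: to_fract_single g)
  then have "to_fract p = 0" unfolding sum .
  then have "p = 0" by (simp only: to_fract_eq_0_iff)
  then have "0 = Poly_Mapping.lookup p (Poly_Mapping.single (XVar i j) 1)" by simp
  also have "\<dots> = (\<Sum>q\<in>UNIV. if q = (i, j) then g q else 0)"
    unfolding lookup_sum p_def
    by (rule sum.cong) (auto simp: lookup_single when_def dest: arg_cong[where f = Poly_Mapping.keys])
  finally show ?thesis by (simp add: g)
qed

lemma picard_vessiot_ratfun: "picard_vessiot D (range rconst)"
proof -
  let ?F = "range rconst :: ('n, 'a) ratfun set"
  let ?N = "CARD('n \<times> 'n)"
  let ?X = "\<lambda>(i, j). rX i j :: ('n, 'a) ratfun"
  obtain es :: "('n \<times> 'n) list" where es: "set es = UNIV" "distinct es"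
    using finite_distinct_list[OF finite, of "UNIV :: ('n \<times> 'n) set"] by auto
  have len: "length es = ?N" using distinct_card[OF es(2)] es(1) by simp
  have W: "wronskian D (map ?X es) \<noteq> 0"
  proof
    assume "wronskian D (map ?X es) = 0"
    then obtain c where c: "\<forall>e\<in>UNIV. c e \<in> constants D" "\<exists>e. c e \<noteq> 0"
        "(\<Sum>e\<in>UNIV. c e * ?X e) = 0"
      unfolding wronskian_map_eq_0_iff[OF D es(2)] es(1) by auto
    have "c (i, j) = 0" for i j
      by (rule rX_independent) (use c(1,3) in \<open>simp_all add: case_prod_unfold\<close>)
    then show False using c(2) by auto
  qed
  \<comment> \<open>One equation for each of the \<open>?N\<close> matrix entries, against
    \<open>?N + 1\<close> unknowns.\<close>
  obtain x where x: "\<exists>r\<in>{..?N}. x r \<noteq> 0"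
      "\<forall>p\<in>UNIV. (\<Sum>r\<in>{..?N}. x r * (\<lambda>(i, l). Acoeff r i l) p) = 0"
    using homogeneous_system_nontrivial_solution[OF is_subfield_UNIV, of "UNIV :: ('n \<times> 'n) set" "{..?N}"
        "\<lambda>r (i, l). Acoeff r i l"] by auto
  define M where "M = Max {r. r \<le> ?N \<and> x r \<noteq> 0}"
  have "M \<in> {r. r \<le> ?N \<and> x r \<noteq> 0}"
    unfolding M_def by (rule Max_in) (use x(1) in auto)
  then have M: "M \<le> ?N" "x M \<noteq> 0" by auto
  have above: "x r = 0" if "M < r" "r \<le> ?N" for r
  proof (rule ccontr)
    assume "x r \<noteq> 0"
    then have "r \<le> M" unfolding M_def using that by (intro Max_ge) auto
    then show False using that by simp
  qed
  \<comment> \<open>Division by the top nonzero coefficient makes the equation monic of order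
    \<open>M\<close>.\<close>
  define a :: "nat \<Rightarrow> ('n, 'a) ratfun" where "a r = rconst (x r / x M)" for r
  have rel: "(\<Sum>r\<le>M. x r * Acoeff r i l) = 0" for i l
  proof -
    have "(\<Sum>r\<le>M. x r * Acoeff r i l) = (\<Sum>r\<le>?N. x r * Acoeff r i l)"
      by (rule sum.mono_neutral_left) (use M(1) above in auto)
    then show ?thesis using x(2) by (auto dest: spec[of _ "(i, l)"])
  qed
  have sol: "?X p \<in> lin_ode_solutions D M a" for p
  proof -
    obtain i j where p: "p = (i, j)" by (cases p)
    have "(\<Sum>r\<le>M. rconst (x r) * (D ^^ r) (rX i j)) =
        (\<Sum>r\<le>M. \<Sum>l\<in>UNIV. rconst (x r * Acoeff r i l) * rX l j)"
      by (simp add: funpow_D_rX sum_distrib_left rconst.hom_mult mult.assoc)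
    also have "\<dots> = (\<Sum>l\<in>UNIV. rconst (\<Sum>r\<le>M. x r * Acoeff r i l) * rX l j)"
      by (subst sum.swap) (simp add: rconst.hom_sum sum_distrib_right)
    also have "\<dots> = 0" by (simp add: rel)
    finally have "rconst (x M) * (D ^^ M) (rX i j) + (\<Sum>r<M. rconst (x r) * (D ^^ r) (rX i j)) = 0"
      by (simp add: lessThan_Suc_atMost[symmetric] add.commute)
    then have "(rconst (x M) * (D ^^ M) (rX i j) + (\<Sum>r<M. rconst (x r) * (D ^^ r) (rX i j))) / rconst (x M) = 0"
      by simp
    then have "(D ^^ M) (rX i j) + (\<Sum>r<M. a r * (D ^^ r) (rX i j)) = 0"
      using M(2) by (simp add: add_divide_distrib sum_divide_distrib a_def field_hom_divide[OF comm_ring_hom_rconst])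
    then show ?thesis by (simp add: p lin_ode_solutions_def)
  qed
  \<comment> \<open>An equation of smaller order would force the wronskian of its \<open>?N\<close>
    solutions \<open>X_ij\<close> to vanish.\<close>
  have "M = ?N"
  proof (rule ccontr)
    assume "M \<noteq> ?N"
    then have "wronskian D (map ?X es) = 0"
      using M(1) len sol by (intro wronskian_lin_ode_solutions[of _ D M a]) auto
    then show False using W by contradiction
  qed
  have "has_dim (constants D) (lin_ode_solutions D ?N a) ?N"
  proof (rule has_dim_lin_ode_solutions[OF D, of ?N "\<lambda>s. ?X (es ! s)"])
    show "?X (es ! s) \<in> lin_ode_solutions D ?N a" for s using sol \<open>M = ?N\<close> by simp
    fix c :: "nat \<Rightarrow> ('n, 'a) ratfun"
    assume "\<And>s. s < ?N \<Longrightarrow> c s \<in> constants D" "(\<Sum>s<?N. c s * ?X (es ! s)) = 0"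
    then show "\<forall>s<?N. c s = 0"
      using W wronskian_eq_0_iff[OF D, of "map ?X es"] by (auto simp: len)
  qed
  moreover have "constants D \<inter> ?F = constants D" using no_new_constants by auto
  moreover have F: "diff_subfield D ?F"
    using rconst_image_subfield[OF is_subfield_UNIV] by (auto simp: diff_subfield_def Drconst)
  moreover have "diff_subfield D hull (?F \<union> lin_ode_solutions D ?N a) = UNIV"
  proof -
    have "T = UNIV" if T: "diff_subfield D T" "?F \<union> lin_ode_solutions D ?N a \<subseteq> T" for T
    proof (rule subfield_ratfun_UNIV)
      show "rX i j \<in> T" for i j using sol[of "(i, j)"] T(2) \<open>M = ?N\<close> by auto
    qed (use T in \<open>auto simp: diff_subfield_def\<close>)
    then show ?thesis unfolding hull_def by blast
  qed
  moreover have "\<forall>i<?N. a i \<in> ?F" by (simp add: a_def)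
  ultimately show ?thesis
    unfolding picard_vessiot_def using D no_new_constants by auto
qed

lemma picard_vessiot_GL_ratfun: "picard_vessiot_GL D (range rconst) rXmat"
proof -
  have "constants D \<inter> range rconst = constants D" using no_new_constants by auto
  then show ?thesis
    using galois_iso picard_vessiot_ratfun
    by (simp add: picard_vessiot_GL_def Finite_Cartesian_Product.vec_eq_iff)
qed

end

theorem theorem2:
  fixes d :: "'a::field_char_0 \<Rightarrow> 'a"
    and m q :: nat
    and t z :: "nat \<Rightarrow> 'a"
    and f :: "'n::finite \<Rightarrow> 'n \<Rightarrow> 'a"
    and D :: "('n, 'a) ratfun \<Rightarrow> ('n, 'a) ratfun"
    and mle :: "'n tXmonom \<Rightarrow> 'n tXmonom \<Rightarrow> bool"
  assumes "derivation d"
    and "alg_closed_on (constants d)"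
    and "alg_independent (constants d) {..<m} t"
    and "\<forall>i<q. algebraic_over (is_subfield hull (constants d \<union> t ` {..<m})) (z i)"
    and "is_subring hull ((is_subfield hull (constants d \<union> t ` {..<m})) \<union> z ` {..<q}) = UNIV"
    and "derivation D"
    and "\<forall>a. D (rconst a) = rconst (d a)"
    and "\<forall>i j. D (rX i j) = (\<Sum>l\<in>UNIV. rconst (f i l) * rX l j)"
    and "term_order_on (tX_monoms m) mle"
  shows "picard_vessiot_GL D (range rconst) (\<chi> i j. rX i j) \<longleftrightarrow>
         (\<forall>k\<ge>1. specialize d f (Wk d m t mle k) \<noteq> 0)"
proof -
  have Drconst: "D (rconst a) = rconst (d a)"
    and DX: "D (rX i j) = (\<Sum>l\<in>UNIV. rconst (f i l) * rX l j)" for a i j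
    using assms(7,8) by blast+
  have "(\<forall>k\<ge>1. specialize d f (Wk d m t mle k) \<noteq> 0) \<longleftrightarrow> constants D \<subseteq> range rconst"
    using wronskians_nonzero_iff_alg_independent[OF assms(1,6) Drconst DX assms(9)]
      alg_independent_iff_no_new_constants[OF assms(1,6) Drconst assms(2,3,4,5)]
    by (rule trans)
  \<comment> \<open>Absence of new constants is part of the definition of
    \<open>picard_vessiot\<close>, which gives one direction at once; the other is
    \<open>picard_vessiot_GL_ratfun\<close>.\<close>
  also have "\<dots> \<longleftrightarrow> picard_vessiot_GL D (range rconst) rXmat"
    using picard_vessiot_GL_ratfun[OF assms(1,6) Drconst DX]
    by (auto simp: picard_vessiot_GL_def picard_vessiot_def)
  finally show ?thesis by blast
qed

end
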